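(* There is an absolute constant $C>0$ such that the following holds. Let $B_1$ be the unit disk in $\mathbb{R}^2$ and $B_{\frac12}$ the concentric disk of radius $\frac12$. If $f\in \mathscr{H}^1(B_1)$, $u\geq 0$ in $B_1$ and $$\triangle u(x)=f(x),\quad x\in B_1,$$ where $u,f$ are smooth in $B_1$, then $$\max_{x\in B_{\frac 12}}u(x)\leq C\left(\min_{y\in B_{\frac 12}}u(y)+\|f\|_{\mathscr{H}^1(B_1)}\right).$$
   Context: Fix a Schwartz function $\Phi$ on $\mathbb{R}^n$ with $\int_{\mathbb{R}^n}\Phi(x)\,dx=1$ and set $\Phi_t(x)=t^{-n}\Phi(x/t)$. The Hardy space $\mathscr{H}^1(\mathbb{R}^n)$ is the space of all tempered distributions $f$ with $$\|f\|_{\mathscr{H}^1}=\left\|\sup_{t>0}|f*\Phi_t|\right\|_{L^1}<\infty .$$ Here $n=2$; $f\in\mathscr{H}^1(B_1)$ means that the extension of $f$ by zero outside $B_1$ belongs to $\mathscr{H}^1(\mathbb{R}^2)$, and $\|f\|_{\mathscr{H}^1(B_1)}$ is the $\mathscr{H}^1$-norm of this extension. The function $\Phi$ is fixed once and for all. $\triangle$ is the Euclidean Laplacian. The maximum and minimum over $B_{\frac12}$ are understood as supremum and infimum. *)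

theory Defs
  imports "HOL-Analysis.Analysis"
begin

section \<open>Smooth functions and the Laplacian\<close>

definition dir_deriv ::
    "('a::euclidean_space \<Rightarrow> 'b::real_normed_vector) \<Rightarrow> 'a \<Rightarrow> 'a \<Rightarrow> 'b" where
  "dir_deriv f b x = frechet_derivative f (at x) b"

text \<open>A multi-index is encoded as the list of the coordinate directions (elements of
  \<^term>\<open>Basis\<close>) in which one differentiates successively; its order is the length of the list.\<close>

definition iter_deriv ::
    "'a::euclidean_space list \<Rightarrow> ('a \<Rightarrow> 'b::real_normed_vector) \<Rightarrow> 'a \<Rightarrow> 'b" where
  "iter_deriv bs f = foldr (\<lambda>b g. dir_deriv g b) bs f"

text \<open>To be used for open sets only. Frechet differentiability of all iterated partial derivatives
  makes each of them continuous, so this is membership in the class of infinitely often continuously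
  differentiable functions. The derivatives are two-sided, hence at points of an open \<open>S\<close> they do
  not depend on the values of \<open>f\<close> outside \<open>S\<close>.\<close>

definition smooth_on ::
    "'a::euclidean_space set \<Rightarrow> ('a \<Rightarrow> 'b::real_normed_vector) \<Rightarrow> bool" where
  "smooth_on S f \<longleftrightarrow>
     (\<forall>bs. set bs \<subseteq> Basis \<longrightarrow> (\<forall>x\<in>S. iter_deriv bs f differentiable (at x)))"

definition laplacian :: "('a::euclidean_space \<Rightarrow> real) \<Rightarrow> 'a \<Rightarrow> real" where
  "laplacian u x = (\<Sum>b\<in>Basis. dir_deriv (dir_deriv u b) b x)"


section \<open>Schwartz functions and tempered distributions\<close>

definition schwartz :: "('a::euclidean_space \<Rightarrow> complex) set" where
  "schwartz = {\<phi>. smooth_on UNIV \<phi> \<and>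
     (\<forall>N bs. set bs \<subseteq> Basis \<longrightarrow>
        bdd_above (range (\<lambda>x. (1 + norm x) ^ N * norm (iter_deriv bs \<phi> x))))}"

definition schwartz_norm :: "nat \<Rightarrow> ('a::euclidean_space \<Rightarrow> complex) \<Rightarrow> real" where
  "schwartz_norm N \<phi> =
     (SUP (x, bs) \<in> UNIV \<times> {bs. set bs \<subseteq> Basis \<and> length bs \<le> N}.
        (1 + norm x) ^ N * norm (iter_deriv bs \<phi> x))"

text \<open>Complex-linear functionals on \<^term>\<open>schwartz\<close> that are continuous for the topology of the
  increasing family of norms \<^term>\<open>schwartz_norm N\<close>. The values of \<open>T\<close> on functions outside
  \<^term>\<open>schwartz\<close> are irrelevant.\<close>

definition tempered_distribution :: "(('a::euclidean_space \<Rightarrow> complex) \<Rightarrow> complex) \<Rightarrow> bool" where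
  "tempered_distribution T \<longleftrightarrow>
     (\<forall>\<phi>\<in>schwartz. \<forall>\<psi>\<in>schwartz. T (\<lambda>x. \<phi> x + \<psi> x) = T \<phi> + T \<psi>) \<and>
     (\<forall>c. \<forall>\<phi>\<in>schwartz. T (\<lambda>x. c * \<phi> x) = c * T \<phi>) \<and>
     (\<exists>N C. \<forall>\<phi>\<in>schwartz. norm (T \<phi>) \<le> C * schwartz_norm N \<phi>)"

definition distr_convolution ::
    "(('a::euclidean_space \<Rightarrow> complex) \<Rightarrow> complex) \<Rightarrow> ('a \<Rightarrow> complex) \<Rightarrow> 'a \<Rightarrow> complex" where
  "distr_convolution T \<phi> x = T (\<lambda>y. \<phi> (x - y))"

definition regular_distribution ::
    "('a::euclidean_space \<Rightarrow> complex) \<Rightarrow> ('a \<Rightarrow> complex) \<Rightarrow> complex" where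
  "regular_distribution F \<phi> = (LINT y|lborel. F y * \<phi> y)"


section \<open>The Hardy space\<close>

definition dilate :: "('a::euclidean_space \<Rightarrow> complex) \<Rightarrow> real \<Rightarrow> 'a \<Rightarrow> complex" where
  "dilate \<Phi> t x = (1 / t ^ DIM('a)) *\<^sub>R \<Phi> (x /\<^sub>R t)"

definition hardy_norm ::
    "('a::euclidean_space \<Rightarrow> complex) \<Rightarrow> (('a \<Rightarrow> complex) \<Rightarrow> complex) \<Rightarrow> ennreal" where
  "hardy_norm \<Phi> T =
     (\<integral>\<^sup>+x. (SUP t\<in>{0<..}. ennreal (norm (distr_convolution T (dilate \<Phi> t) x))) \<partial>lborel)"

definition hardy_space ::
    "('a::euclidean_space \<Rightarrow> complex) \<Rightarrow> (('a \<Rightarrow> complex) \<Rightarrow> complex) set" where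
  "hardy_space \<Phi> = {T. tempered_distribution T \<and> hardy_norm \<Phi> T < \<infinity>}"

definition zero_ext :: "'a set \<Rightarrow> ('a \<Rightarrow> real) \<Rightarrow> 'a \<Rightarrow> complex" where
  "zero_ext S f x = (if x \<in> S then complex_of_real (f x) else 0)"

text \<open>Integrability of the extension makes its identification with a distribution meaningful
  (the Bochner integral of a non-integrable function is 0 by convention). It is not a restriction
  on a function whose distribution lies in the Hardy space, since that space is contained
  in \<open>L\<^sup>1\<close>.\<close>

definition hardy_on ::
    "('a::euclidean_space \<Rightarrow> complex) \<Rightarrow> 'a set \<Rightarrow> ('a \<Rightarrow> real) \<Rightarrow> bool" where
  "hardy_on \<Phi> S f \<longleftrightarrow>
     integrable lborel (zero_ext S f) \<and>
     regular_distribution (zero_ext S f) \<in> hardy_space \<Phi>"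

text \<open>Only meaningful under \<^term>\<open>hardy_on \<Phi> S f\<close>, where the extended norm is finite.\<close>

definition hardy_norm_on ::
    "('a::euclidean_space \<Rightarrow> complex) \<Rightarrow> 'a set \<Rightarrow> ('a \<Rightarrow> real) \<Rightarrow> real" where
  "hardy_norm_on \<Phi> S f = enn2real (hardy_norm \<Phi> (regular_distribution (zero_ext S f)))"

end

theory Submission
  imports Defs
begin

text \<open>Two ideas combine: an exact formula for the amount by which a solution of the Poisson equation
  fails the mean value property, and a duality between the Hardy space and kernels with a
  logarithmic singularity.

  Let \<open>\<omega>\<close> be the radial bump \<open>((1 - |z|\<^sup>2)\<^sub>+)\<^sup>2\<close> and \<open>\<chi> = 4 (1 - |z|\<^sup>2)\<^sub>+\<close>, so that
  \<open>\<nabla>\<omega> = - \<chi> z\<close>. Differentiating the weighted mean \<open>A(R) = \<integral> u(x + R z) \<chi>(z) dz\<close> in \<open>R\<close> and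
  integrating by parts once gives
  \<open>A(R) - A(0) = \<integral>\<^sub>0\<^sup>R r \<integral> \<triangle>u(x + r z) \<omega>(z) dz dr\<close> (\<open>mean_value_defect\<close>).
  In dimension two the substitution \<open>y = r z\<close> turns the right-hand side into
  \<open>\<integral>\<^sub>0\<^sup>R \<integral> f(x + y) \<omega>(y/r) dy dr/r\<close>, the pairing of \<open>f\<close> with a kernel that behaves like
  \<open>log (R/|y|)\<close>.

  Such a pairing is controlled by the vertical maximal function \<open>M = sup\<^sub>t |F * \<Phi>\<^sub>t|\<close> without any
  appeal to atoms, to other maximal functions or to the space BMO
  (\<open>hardy_multiscale_bound\<close>). Since \<open>\<integral>\<Phi> = 1\<close>, some annulus \<open>E = {a \<le> |z| \<le> b}\<close> has
  \<open>m = \<integral>\<^sub>E \<Phi> \<noteq> 0\<close>. With \<open>\<psi>(w) = \<integral>\<^sub>E \<Phi>(z - w) dz\<close>, the pairing of \<open>F(x + y)\<close> with \<open>\<psi>(y/r)\<close> is an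
  integral of values of \<open>F * \<Phi>\<^sub>r\<close> over \<open>x + rE\<close>, hence at most the integral of \<open>M\<close> over that set;
  and a given point lies in \<open>x + rE\<close> only for a set of radii of bounded measure for \<open>dr/r\<close>. The
  difference \<open>\<rho> = \<omega> - (\<omega>(0)/m) \<psi>\<close> vanishes at \<open>0\<close>, is Lipschitz there and decays at infinity, so
  \<open>\<integral>\<^sub>0\<^sup>\<infinity> |\<rho>(y/r)| dr/r\<close> is bounded uniformly in \<open>y\<close>, and its contribution is at most a constant
  times \<open>\<integral>|F| \<le> \<integral>M\<close>. The last inequality holds because the approximate identity recovers \<open>F\<close> at its
  continuity points (\<open>norm_le_vertical_maximal\<close>), which include all of the disk outside of which
  the extended \<open>f\<close> vanishes.

  Consequently \<open>u(x)\<close> equals a weighted mean of \<open>u\<close> around \<open>x\<close>, up to an error of size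
  \<open>\<integral>M\<close> (\<open>mean_value_hardy_estimate\<close>). For \<open>u \<ge> 0\<close> a mean over a small disk is at most a
  constant times a mean over a larger disk with a nearby centre, and chaining eight such comparisons
  inside \<open>B\<^sub>1\<^sub>/\<^sub>2\<close> gives the Harnack inequality.\<close>

section \<open>Integration on Euclidean spaces\<close>

lemma nn_integral_lborel_affine:
  fixes f :: "'a::euclidean_space \<Rightarrow> ennreal"
  assumes [measurable]: "f \<in> borel_measurable borel" and c: "c \<noteq> 0"
  shows "(\<integral>\<^sup>+x. f x \<partial>lborel) = ennreal (\<bar>c\<bar> ^ DIM('a)) * (\<integral>\<^sup>+x. f (t + c *\<^sub>R x) \<partial>lborel)"
  by (subst lborel_affine[OF c, of t])
     (simp add: nn_integral_density nn_integral_distr nn_integral_cmult)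

lemma integrable_lborel_affine:
  fixes f :: "'a::euclidean_space \<Rightarrow> 'b::{banach, second_countable_topology}"
  assumes f: "integrable lborel f" and c: "c \<noteq> 0"
  shows "integrable lborel (\<lambda>x. f (t + c *\<^sub>R x))"
proof -
  have [measurable]: "f \<in> borel_measurable borel"
    using f borel_measurable_integrable by auto
  have "(\<integral>\<^sup>+x. norm (f x) \<partial>lborel) < \<infinity>"
    using f by (simp add: integrable_iff_bounded)
  then have "ennreal (\<bar>c\<bar> ^ DIM('a)) * (\<integral>\<^sup>+x. norm (f (t + c *\<^sub>R x)) \<partial>lborel) < \<infinity>"
    by (subst (asm) nn_integral_lborel_affine[OF _ c, of _ t]) auto
  then show ?thesis
    using c by (auto simp: integrable_iff_bounded ennreal_mult_less_top)
qed

lemma integral_lborel_affine: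
  fixes f :: "'a::euclidean_space \<Rightarrow> 'b::{banach, second_countable_topology}"
  assumes [measurable]: "f \<in> borel_measurable borel" and c: "c \<noteq> 0"
  shows "(\<integral>x. f x \<partial>lborel) = \<bar>c\<bar> ^ DIM('a) *\<^sub>R (\<integral>x. f (t + c *\<^sub>R x) \<partial>lborel)"
  by (subst lborel_affine[OF c, of t]) (simp add: integral_density integral_distr)

lemma integrable_compact_support:
  fixes g :: "'a::euclidean_space \<Rightarrow> 'b::{banach, second_countable_topology}"
  assumes "compact K" "continuous_on K g" "\<And>x. x \<notin> K \<Longrightarrow> g x = 0"
  shows "integrable lborel g"
proof -
  have "(\<lambda>x. indicator K x *\<^sub>R g x) = g"
    using assms(3) by (auto simp: indicator_def fun_eq_iff)
  with borel_integrable_compact[OF assms(1,2)] show ?thesis by simp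
qed

text \<open>Integrating the fundamental theorem of calculus along the segments from \<open>z\<close> to \<open>z + b\<close> over
  all \<open>z\<close>, translation invariance makes the increment of \<open>g\<close> integrate to zero, and Fubini makes the
  integrated derivative contribute \<open>\<integral> \<partial>\<^sub>b g\<close> for each parameter in the unit interval. This replaces
  the divergence theorem and involves no boundary.\<close>

lemma integral_derivative_zero:
  fixes g :: "'a::euclidean_space \<Rightarrow> real"
  assumes K: "compact K"
    and der: "\<And>z. (g has_derivative g' z) (at z)"
    and cont: "continuous_on UNIV (\<lambda>z. g' z b)"
    and g0: "\<And>z. z \<notin> K \<Longrightarrow> g z = 0" and g'0: "\<And>z. z \<notin> K \<Longrightarrow> g' z b = 0"
  shows "(\<integral>z. g' z b \<partial>lborel) = 0"
proof -
  define d where "d = (\<lambda>z. g' z b)"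
  have contd: "continuous_on S d" for S
    using cont continuous_on_subset unfolding d_def by blast
  have intg: "integrable lborel g"
    by (rule integrable_compact_support[OF K _ g0])
       (use der has_derivative_continuous in \<open>blast intro: continuous_at_imp_continuous_on\<close>)
  have intd: "integrable lborel d"
    by (rule integrable_compact_support[OF K contd]) (simp add: d_def g'0)
  \<comment> \<open>The integrand \<open>d (z + t b)\<close> on \<open>[0, 1] \<times> \<real>\<^sup>n\<close> is supported in the sheared cylinder \<open>L\<close>.\<close>
  define L where "L = (\<lambda>p::real \<times> 'a. (fst p, snd p - fst p *\<^sub>R b)) ` ({0..1} \<times> K)"
  have "compact L"
    unfolding L_def by (intro compact_continuous_image continuous_intros compact_Times K compact_Icc)
  have inL: "(t, z) \<in> L \<longleftrightarrow> t \<in> {0..1} \<and> z + t *\<^sub>R b \<in> K" for t z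
    unfolding L_def by (auto simp: image_iff) (metis atLeastAtMost_iff add_diff_cancel_right')
  have int2: "integrable (lborel \<Otimes>\<^sub>M lborel) (\<lambda>(t, z). indicator {0..1::real} t *\<^sub>R d (z + t *\<^sub>R b))"
  proof -
    have "continuous_on L (\<lambda>p. d (snd p + fst p *\<^sub>R b))"
      by (rule continuous_on_compose2[OF contd[of UNIV]]) (auto intro!: continuous_intros)
    from borel_integrable_compact[OF \<open>compact L\<close> this]
    have *: "integrable lborel (\<lambda>p. indicator L p *\<^sub>R d (snd p + fst p *\<^sub>R b))" .
    have "(\<lambda>p. indicator L p *\<^sub>R d (snd p + fst p *\<^sub>R b))
        = (\<lambda>(t, z). indicator {0..1::real} t *\<^sub>R d (z + t *\<^sub>R b))"
      by (auto simp: fun_eq_iff indicator_def inL d_def g'0)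
    with * show ?thesis by (simp add: lborel_prod)
  qed
  have ftc: "(\<integral>t. indicator {0..1} t *\<^sub>R d (z + t *\<^sub>R b) \<partial>lborel) = g (z + b) - g z" for z
  proof -
    have "((\<lambda>t. g (z + t *\<^sub>R b)) has_vector_derivative d (z + t *\<^sub>R b)) (at t within {0..1})" for t
    proof -
      have 1: "((\<lambda>t. z + t *\<^sub>R b) has_derivative (\<lambda>t. t *\<^sub>R b)) (at t within {0..1})"
        by (auto intro!: derivative_eq_intros)
      have "((\<lambda>t. g (z + t *\<^sub>R b)) has_derivative (\<lambda>s. g' (z + t *\<^sub>R b) (s *\<^sub>R b))) (at t within {0..1})"
        by (rule has_derivative_compose[OF 1 der])
      then show ?thesis
        unfolding has_vector_derivative_def d_def
        using linear_cmul[OF has_derivative_linear[OF der]] by simp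
    qed
    then have "(\<integral>t. indicator {0..1} t *\<^sub>R d (z + t *\<^sub>R b) \<partial>lborel) = g (z + 1 *\<^sub>R b) - g (z + 0 *\<^sub>R b)"
      by (intro integral_FTC_atLeastAtMost continuous_on_compose2[OF contd[of UNIV]])
         (auto intro!: continuous_intros)
    then show ?thesis by simp
  qed
  have shift: "(\<integral>z. h (z + v) \<partial>lborel) = (\<integral>z. h z \<partial>lborel)"
    if "integrable lborel h" for h :: "'a \<Rightarrow> real" and v
    using integral_lborel_affine[of h 1 v] that borel_measurable_integrable[OF that]
    by (simp add: add.commute)
  have "0 = (\<integral>z. g (z + b) - g z \<partial>lborel)"
    using intg integrable_lborel_affine[OF intg, of 1 b] shift[OF intg, of b]
    by (simp add: add.commute)
  also have "\<dots> = (\<integral>z. (\<integral>t. indicator {0..1} t *\<^sub>R d (z + t *\<^sub>R b) \<partial>lborel) \<partial>lborel)"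
    by (simp only: ftc)
  also have "\<dots> = (\<integral>t. (\<integral>z. indicator {0..1} t *\<^sub>R d (z + t *\<^sub>R b) \<partial>lborel) \<partial>lborel)"
    by (rule lborel_pair.Fubini_integral[OF int2])
  also have "\<dots> = (\<integral>t. indicator {0..1::real} t *\<^sub>R (\<integral>z. d z \<partial>lborel) \<partial>lborel)"
    by (simp add: shift[OF intd])
  also have "\<dots> = (\<integral>z. d z \<partial>lborel)"
    by simp
  finally show ?thesis by (simp add: d_def)
qed

section \<open>The defect in the mean value property\<close>

lemma iter_deriv_dir_deriv: "iter_deriv bs (dir_deriv u b) = iter_deriv (bs @ [b]) u"
  by (simp add: iter_deriv_def)

lemma smooth_on_dir_deriv:
  assumes "smooth_on S u" "b \<in> Basis"
  shows "smooth_on S (dir_deriv u b)"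
  using assms unfolding smooth_on_def iter_deriv_dir_deriv by simp

lemma smooth_on_differentiable:
  assumes "smooth_on S u" "x \<in> S"
  shows "u differentiable (at x)"
  using assms(1)[unfolded smooth_on_def, rule_format, of "[]" x] assms(2)
  by (simp add: iter_deriv_def)

lemma smooth_on_continuous_on:
  assumes "smooth_on S u"
  shows "continuous_on S u"
  using smooth_on_differentiable[OF assms]
  by (intro continuous_at_imp_continuous_on ballI differentiable_imp_continuous_within)

lemma frechet_derivative_dir_deriv:
  fixes u :: "'a::euclidean_space \<Rightarrow> 'b::real_normed_vector"
  assumes "u differentiable (at x)"
  shows "frechet_derivative u (at x) v = (\<Sum>b\<in>Basis. (v \<bullet> b) *\<^sub>R dir_deriv u b x)"
proof -
  interpret linear "frechet_derivative u (at x)"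
    by (rule linear_frechet_derivative[OF assms])
  have "frechet_derivative u (at x) (\<Sum>b\<in>Basis. (v \<bullet> b) *\<^sub>R b)
      = (\<Sum>b\<in>Basis. (v \<bullet> b) *\<^sub>R dir_deriv u b x)"
    by (simp add: sum scaleR dir_deriv_def)
  then show ?thesis by (simp add: euclidean_representation)
qed

text \<open>The square is the least integer power for which the truncated paraboloid is continuously
  differentiable, and one integration by parts needs no more.\<close>

definition bump :: "'a::real_inner \<Rightarrow> real" where
  "bump z = (max 0 (1 - (norm z)\<^sup>2))\<^sup>2"

text \<open>The radial factor in the gradient of the bump: \<open>\<nabla>bump(z) = - bump_weight(z) z\<close>.\<close>

definition bump_weight :: "'a::real_inner \<Rightarrow> real" where
  "bump_weight z = 4 * max 0 (1 - (norm z)\<^sup>2)"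

lemma bump_eq_0: "1 \<le> norm z \<Longrightarrow> bump z = 0"
  and bump_weight_eq_0: "1 \<le> norm z \<Longrightarrow> bump_weight z = 0"
  by (auto simp: bump_def bump_weight_def max_def dest: one_le_power[of _ 2])

lemma bump_weight_nonneg: "0 \<le> bump_weight z"
  by (simp add: bump_weight_def)

lemma continuous_on_bump: "continuous_on S bump"
  and continuous_on_bump_weight: "continuous_on S bump_weight"
  unfolding bump_def bump_weight_def by (intro continuous_intros)+

lemma has_real_derivative_max_0_power2:
  "((\<lambda>t::real. (max 0 t)\<^sup>2) has_real_derivative 2 * max 0 t) (at t)"
proof -
  \<comment> \<open>The derivative of \<open>(t\<^sub>+)\<^sup>2\<close> is Lipschitz with constant 2, so the Taylor remainder is quadratic.\<close>
  have bound: "\<bar>(max 0 (t + h))\<^sup>2 - (max 0 t)\<^sup>2 - 2 * max 0 t * h\<bar> \<le> h\<^sup>2" for h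
  proof -
    consider "t \<ge> 0" "t + h \<ge> 0" | "t \<ge> 0" "t + h < 0" | "t < 0" "t + h \<ge> 0" | "t < 0" "t + h < 0"
      by linarith
    then show ?thesis
    proof cases
      case 1
      then show ?thesis by (simp add: max_def power2_eq_square algebra_simps)
    next
      case 2
      then have "(t + h) * (t + h) \<le> h * h"
        using abs_le_square_iff[of "t + h" h] by (simp add: power2_eq_square)
      moreover have "(t + h) * (t + h) \<ge> 0" by simp
      ultimately have "\<bar>t * t + 2 * t * h\<bar> \<le> h * h"
        by (auto simp: abs_le_iff algebra_simps)
      then show ?thesis using 2 by (auto simp: max_def power2_eq_square abs_minus_commute)
    next
      case 3
      then have "(t + h) * (t + h) \<le> h * h" by (intro mult_mono) auto
      then show ?thesis using 3 by (auto simp: max_def power2_eq_square)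
    next
      case 4
      then show ?thesis by (auto simp: max_def power2_eq_square)
    qed
  qed
  have "((\<lambda>h. ((max 0 (t + h))\<^sup>2 - (max 0 t)\<^sup>2) / h - 2 * max 0 t) \<longlongrightarrow> 0) (at 0)"
  proof (rule Lim_null_comparison)
    show "\<forall>\<^sub>F h in at 0. norm (((max 0 (t + h))\<^sup>2 - (max 0 t)\<^sup>2) / h - 2 * max 0 t) \<le> \<bar>h\<bar>"
    proof (rule eventually_at_filter[THEN iffD2], rule always_eventually, intro allI impI)
      fix h :: real assume h: "h \<noteq> 0"
      have "((max 0 (t + h))\<^sup>2 - (max 0 t)\<^sup>2) / h - 2 * max 0 t
          = ((max 0 (t + h))\<^sup>2 - (max 0 t)\<^sup>2 - 2 * max 0 t * h) / h"
        using h by (simp add: field_simps)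
      then show "norm (((max 0 (t + h))\<^sup>2 - (max 0 t)\<^sup>2) / h - 2 * max 0 t) \<le> \<bar>h\<bar>"
        using bound[of h] h by (simp add: abs_divide divide_le_eq power2_eq_square)
    qed
    show "((\<lambda>h. \<bar>h\<bar>) \<longlongrightarrow> 0) (at (0::real))"
      by (auto intro!: tendsto_eq_intros)
  qed
  then show ?thesis
    unfolding DERIV_def by (simp add: LIM_zero_iff)
qed

lemma has_derivative_bump:
  "(bump has_derivative (\<lambda>v. - (bump_weight z * (z \<bullet> v)))) (at z)"
proof -
  have "((\<lambda>z. 1 - (z \<bullet> z)) has_derivative (\<lambda>v. - (2 * (z \<bullet> v)))) (at z)"
    by (auto intro!: derivative_eq_intros simp: inner_commute)
  from has_derivative_compose[OF this
      has_real_derivative_max_0_power2[unfolded has_field_derivative_def]]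
  show ?thesis
    unfolding bump_def bump_weight_def power2_norm_eq_inner
    by (simp add: algebra_simps)
qed

text \<open>The function \<open>u\<close> is only controlled on a ball, so integrands such as \<open>u(x + r z) bump(z)\<close> are
  known to be continuous only on the closed unit ball; their vanishing on and beyond the unit sphere
  gives continuity everywhere.\<close>

lemma continuous_on_extend_zero:
  fixes f :: "'a::real_normed_vector \<Rightarrow> 'b::real_normed_vector"
  assumes "continuous_on (cball 0 1) f" "\<And>z. 1 \<le> norm z \<Longrightarrow> f z = 0"
  shows "continuous_on UNIV f"
proof -
  have "continuous_on (- ball 0 1) f"
    by (rule continuous_on_eq[of _ "\<lambda>_. 0"]) (auto simp: assms(2))
  with assms(1) have "continuous_on (cball 0 1 \<union> - ball 0 1) f"
    by (intro continuous_on_closed_Un) auto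
  moreover have "cball 0 1 \<union> - ball 0 1 = (UNIV :: 'a set)" by auto
  ultimately show ?thesis by simp
qed

lemma add_scaleR_mem_cball:
  fixes x z :: "'a::real_normed_vector"
  assumes "norm z \<le> 1" "0 \<le> r" "r \<le> R"
  shows "x + r *\<^sub>R z \<in> cball x R"
  using mult_mono[OF assms(3,1)] assms by (simp add: dist_norm)

lemma continuous_on_add_scaleR:
  fixes h :: "'a::real_normed_vector \<Rightarrow> 'b::topological_space"
  assumes "continuous_on (cball x r) h" "0 \<le> r"
  shows "continuous_on (cball 0 1) (\<lambda>z. h (x + r *\<^sub>R z))"
  by (rule continuous_on_compose2[OF assms(1)])
     (use assms(2) add_scaleR_mem_cball[of _ r r x] in \<open>auto intro!: continuous_intros\<close>)

lemma integrable_times_bump: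
  fixes h :: "'a::euclidean_space \<Rightarrow> real"
  assumes "continuous_on (cball x r) h" "0 \<le> r"
  shows "integrable lborel (\<lambda>z. h (x + r *\<^sub>R z) * bump z)"
    and "integrable lborel (\<lambda>z. h (x + r *\<^sub>R z) * bump_weight z)"
    and "integrable lborel (\<lambda>z. h (x + r *\<^sub>R z) * (z \<bullet> b) * bump_weight z)"
  by (rule integrable_compact_support[of "cball 0 1"],
      auto intro!: continuous_intros continuous_on_bump continuous_on_bump_weight
        continuous_on_add_scaleR assms simp: bump_eq_0 bump_weight_eq_0)+

lemma integral_by_parts_bump:
  fixes h :: "'a::euclidean_space \<Rightarrow> real"
  assumes h: "smooth_on S h" and S: "cball x r \<subseteq> S" and r: "0 \<le> r" and b: "b \<in> Basis"
  shows "(\<integral>z. h (x + r *\<^sub>R z) * (z \<bullet> b) * bump_weight z \<partial>lborel)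
       = r * (\<integral>z. dir_deriv h b (x + r *\<^sub>R z) * bump z \<partial>lborel)"
proof -
  have inS: "x + r *\<^sub>R z \<in> S" if "norm z \<le> 1" for z
    using add_scaleR_mem_cball[OF that r order_refl] S by blast
  have conth: "continuous_on (cball x r) h"
    by (rule continuous_on_subset[OF smooth_on_continuous_on[OF h] S])
  have contd: "continuous_on (cball x r) (dir_deriv h b)"
    by (rule continuous_on_subset[OF smooth_on_continuous_on[OF smooth_on_dir_deriv[OF h b]] S])
  define g where "g z = h (x + r *\<^sub>R z) * bump z" for z
  define g' where "g' z v = frechet_derivative h (at (x + r *\<^sub>R z)) (r *\<^sub>R v) * bump z
      - h (x + r *\<^sub>R z) * (bump_weight z * (z \<bullet> v))" for z v
  have der: "(g has_derivative g' z) (at z)" for z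
  proof (cases "norm z \<le> 1")
    case True
    have "((\<lambda>z. x + r *\<^sub>R z) has_derivative (\<lambda>v. r *\<^sub>R v)) (at z)"
      by (auto intro!: derivative_eq_intros)
    from has_derivative_compose[OF this
        smooth_on_differentiable[OF h inS[OF True], unfolded frechet_derivative_works]]
    have "((\<lambda>z. h (x + r *\<^sub>R z)) has_derivative
        (\<lambda>v. frechet_derivative h (at (x + r *\<^sub>R z)) (r *\<^sub>R v))) (at z)" .
    from has_derivative_mult[OF this has_derivative_bump[of z]]
    show ?thesis unfolding g_def g'_def by (simp add: algebra_simps)
  next
    case False
    then have "z \<in> - cball 0 1" by simp
    have "(g has_derivative (\<lambda>_. 0)) (at z)"
      by (rule has_derivative_transform_within_open[OF has_derivative_const _ \<open>z \<in> _\<close>])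
         (auto simp: g_def bump_eq_0)
    moreover have "g' z = (\<lambda>_. 0)"
      using False by (simp add: g'_def bump_eq_0 bump_weight_eq_0 fun_eq_iff)
    ultimately show ?thesis by simp
  qed
  have g'b: "g' z b = r * (dir_deriv h b (x + r *\<^sub>R z) * bump z)
      - h (x + r *\<^sub>R z) * (z \<bullet> b) * bump_weight z" for z
  proof (cases "norm z \<le> 1")
    case True
    have "frechet_derivative h (at (x + r *\<^sub>R z)) (r *\<^sub>R b) = r * dir_deriv h b (x + r *\<^sub>R z)"
      using linear_cmul[OF linear_frechet_derivative[OF smooth_on_differentiable[OF h inS[OF True]]]]
      by (simp add: dir_deriv_def)
    then show ?thesis by (simp add: g'_def)
  qed (simp add: g'_def bump_eq_0 bump_weight_eq_0)
  have "0 = (\<integral>z. g' z b \<partial>lborel)"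
  proof (rule integral_derivative_zero[of "cball 0 1" g g', symmetric])
    show "continuous_on UNIV (\<lambda>z. g' z b)"
      unfolding g'b
      by (rule continuous_on_extend_zero)
         (auto intro!: continuous_intros continuous_on_bump continuous_on_bump_weight
            continuous_on_add_scaleR conth contd r simp: bump_eq_0 bump_weight_eq_0)
  qed (auto simp: der g_def g'b bump_eq_0 bump_weight_eq_0)
  also have "\<dots> = r * (\<integral>z. dir_deriv h b (x + r *\<^sub>R z) * bump z \<partial>lborel)
      - (\<integral>z. h (x + r *\<^sub>R z) * (z \<bullet> b) * bump_weight z \<partial>lborel)"
    unfolding g'b
    using integrable_times_bump(1)[OF contd r] integrable_times_bump(3)[OF conth r, of b]
    by (subst Bochner_Integration.integral_diff) auto
  finally show ?thesis by simp
qed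

text \<open>For harmonic \<open>u\<close> this is the mean value property. The left-hand side is the integral over
  \<open>r \<in> [0, R]\<close> of the derivative \<open>\<integral> (\<nabla>u(x + r z) \<bullet> z) bump_weight(z) dz\<close> of the weighted mean,
  and the vector field \<open>bump_weight(z) z\<close> is \<open>-\<nabla>bump\<close>, so integration by parts produces the
  Laplacian. Fubini is used instead of differentiation under the integral sign.\<close>

lemma mean_value_defect:
  fixes u :: "'a::euclidean_space \<Rightarrow> real"
  assumes u: "smooth_on S u" and S: "cball x R \<subseteq> S" and R: "0 \<le> R"
  defines "I \<equiv> \<lambda>r. r * (\<integral>z. laplacian u (x + r *\<^sub>R z) * bump z \<partial>lborel)"
  shows "integrable lborel (\<lambda>r. indicator {0..R} r *\<^sub>R I r)" (is ?integrable)
    and "(\<integral>z. u (x + R *\<^sub>R z) * bump_weight z \<partial>lborel) - u x * integral\<^sup>L lborel (bump_weight :: 'a \<Rightarrow> real)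
       = (\<integral>r. indicator {0..R} r *\<^sub>R I r \<partial>lborel)" (is ?identity)
proof -
  define D where "D r z = (\<Sum>b\<in>Basis. dir_deriv u b (x + r *\<^sub>R z) * (z \<bullet> b))" for r z
  define P where "P r z = indicator {0..R} r *\<^sub>R (D r z * bump_weight z)" for r z
  have du: "smooth_on S (dir_deriv u b)" and ddu: "smooth_on S (dir_deriv (dir_deriv u b) b)"
    if "b \<in> Basis" for b
    using that by (auto intro!: smooth_on_dir_deriv u)
  have cont: "continuous_on (cball x r) h" if "smooth_on S h" "r \<le> R" for h :: "'a \<Rightarrow> real" and r
    by (rule continuous_on_subset[OF smooth_on_continuous_on[OF that(1)]
          order_trans[OF subset_cball[OF that(2)] S]])
  have inS: "x + r *\<^sub>R z \<in> S" if "norm z \<le> 1" "0 \<le> r" "r \<le> R" for r z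
    using add_scaleR_mem_cball[OF that] S by blast
  have contP: "continuous_on ({0..R} \<times> cball 0 1) (\<lambda>p. D (fst p) (snd p) * bump_weight (snd p))"
    unfolding D_def
    by (intro continuous_intros continuous_on_compose2[OF smooth_on_continuous_on[OF du]]
          continuous_on_compose2[OF continuous_on_bump_weight[of UNIV]])
       (auto intro: inS)
  have intP: "integrable (lborel \<Otimes>\<^sub>M lborel) (\<lambda>(r, z). P r z)"
  proof -
    have "integrable lborel (\<lambda>p. indicator ({0..R} \<times> cball 0 1) p *\<^sub>R
        (D (fst p) (snd p) * bump_weight (snd p)))"
      by (rule borel_integrable_compact[OF _ contP]) (simp add: compact_Times)
    moreover have "(\<lambda>p. indicator ({0..R} \<times> cball 0 1) p *\<^sub>R
        (D (fst p) (snd p) * bump_weight (snd p))) = (\<lambda>(r, z). P r z)"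
      by (auto simp: fun_eq_iff P_def indicator_def bump_weight_eq_0)
    ultimately show ?thesis by (simp add: lborel_prod)
  qed
  have inner_z: "(\<integral>z. P r z \<partial>lborel) = indicator {0..R} r *\<^sub>R I r" for r
  proof (cases "r \<in> {0..R}")
    case True
    then have r: "0 \<le> r" "r \<le> R" and Sr: "cball x r \<subseteq> S"
      using S by (auto simp: subset_eq)
    have "(\<integral>z. D r z * bump_weight z \<partial>lborel)
        = (\<Sum>b\<in>Basis. \<integral>z. dir_deriv u b (x + r *\<^sub>R z) * (z \<bullet> b) * bump_weight z \<partial>lborel)"
      unfolding D_def sum_distrib_right
      by (subst Bochner_Integration.integral_sum)
         (auto intro!: integrable_times_bump cont du r)
    also have "\<dots> = (\<Sum>b\<in>Basis. r * (\<integral>z. dir_deriv (dir_deriv u b) b (x + r *\<^sub>R z) * bump z \<partial>lborel))"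
      by (intro sum.cong refl integral_by_parts_bump[OF du Sr]) (auto simp: r)
    also have "\<dots> = I r"
      unfolding I_def laplacian_def sum_distrib_right
      by (subst Bochner_Integration.integral_sum)
         (auto intro!: integrable_times_bump cont ddu r simp: sum_distrib_left)
    finally show ?thesis using True by (simp add: P_def)
  qed (simp add: P_def)
  have inner_r: "(\<integral>r. P r z \<partial>lborel) = (u (x + R *\<^sub>R z) - u x) * bump_weight z" for z
  proof (cases "norm z \<le> 1")
    case True
    have "((\<lambda>r. u (x + r *\<^sub>R z)) has_vector_derivative D r z) (at r within {0..R})"
      if r: "0 \<le> r" "r \<le> R" for r
    proof -
      have dif: "u differentiable (at (x + r *\<^sub>R z))"
        using smooth_on_differentiable[OF u inS[OF True r]] .
      have "((\<lambda>r. x + r *\<^sub>R z) has_derivative (\<lambda>s. s *\<^sub>R z)) (at r within {0..R})"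
        by (auto intro!: derivative_eq_intros)
      from has_derivative_compose[OF this dif[unfolded frechet_derivative_works]]
      have "((\<lambda>r. u (x + r *\<^sub>R z)) has_derivative
          (\<lambda>s. frechet_derivative u (at (x + r *\<^sub>R z)) (s *\<^sub>R z))) (at r within {0..R})" .
      moreover have "frechet_derivative u (at (x + r *\<^sub>R z)) (s *\<^sub>R z) = s *\<^sub>R D r z" for s
        unfolding frechet_derivative_dir_deriv[OF dif] D_def
        by (simp add: sum_distrib_left mult_ac)
      ultimately show ?thesis unfolding has_vector_derivative_def by simp
    qed
    moreover have "continuous_on {0..R} (\<lambda>r. D r z)"
      unfolding D_def
      by (intro continuous_intros continuous_on_compose2[OF smooth_on_continuous_on[OF du]])
         (auto intro: inS True)
    ultimately have "(\<integral>r. indicator {0..R} r *\<^sub>R D r z \<partial>lborel) = u (x + R *\<^sub>R z) - u (x + 0 *\<^sub>R z)"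
      by (intro integral_FTC_atLeastAtMost R)
    then have "(\<integral>r. (indicator {0..R} r *\<^sub>R D r z) * bump_weight z \<partial>lborel)
        = (u (x + R *\<^sub>R z) - u x) * bump_weight z"
      by simp
    then show ?thesis by (simp add: P_def mult.assoc)
  qed (simp add: P_def bump_weight_eq_0)
  show ?integrable
    using lborel_pair.integrable_fst[OF intP] by (simp add: inner_z)
  have "(\<integral>z. u (x + R *\<^sub>R z) * bump_weight z \<partial>lborel) - u x * integral\<^sup>L lborel (bump_weight :: 'a \<Rightarrow> real)
      = (\<integral>z. (u (x + R *\<^sub>R z) - u x) * bump_weight z \<partial>lborel)"
    using integrable_times_bump(2)[OF cont[OF u order_refl] R]
      integrable_times_bump(2)[of x R "\<lambda>_. u x"] R
    by (simp add: left_diff_distrib)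
  also have "\<dots> = (\<integral>z. (\<integral>r. P r z \<partial>lborel) \<partial>lborel)"
    by (simp add: inner_r)
  also have "\<dots> = (\<integral>r. (\<integral>z. P r z \<partial>lborel) \<partial>lborel)"
    by (rule lborel_pair.Fubini_integral[OF intP])
  finally show ?identity by (simp add: inner_z)
qed

section \<open>Schwartz functions and the vertical maximal function\<close>

lemma schwartz_decay:
  assumes "\<Phi> \<in> schwartz"
  obtains C where "0 \<le> C" "\<And>v. (1 + norm v) ^ N * norm (\<Phi> v) \<le> C"
proof -
  have "bdd_above (range (\<lambda>x. (1 + norm x) ^ N * norm (\<Phi> x)))"
    using assms by (auto simp: schwartz_def iter_deriv_def dest!: spec[of _ N] spec[of _ "[]"])
  then obtain C where "\<And>v. (1 + norm v) ^ N * norm (\<Phi> v) \<le> C"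
    by (auto simp: bdd_above_def)
  then have "\<And>v. (1 + norm v) ^ N * norm (\<Phi> v) \<le> max 0 C"
    by (meson max.coboundedI2)
  with that[of "max 0 C"] show ?thesis by simp
qed

lemma schwartz_continuous:
  assumes "\<Phi> \<in> schwartz"
  shows "continuous_on UNIV \<Phi>"
  using assms by (auto simp: schwartz_def intro: smooth_on_continuous_on)

lemma schwartz_lipschitz:
  fixes \<Phi> :: "'a::euclidean_space \<Rightarrow> complex"
  assumes "\<Phi> \<in> schwartz"
  obtains L where "0 \<le> L" "\<And>v w. norm (\<Phi> v - \<Phi> w) \<le> L * norm (v - w)"
proof -
  have diff: "\<Phi> differentiable (at x)" for x
    using assms by (auto simp: schwartz_def intro: smooth_on_differentiable)
  have "\<exists>B. \<forall>x. norm (dir_deriv \<Phi> b x) \<le> B" if "b \<in> Basis" for b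
  proof -
    have "bdd_above (range (\<lambda>x. (1 + norm x) ^ 0 * norm (iter_deriv [b] \<Phi> x)))"
      using assms that unfolding schwartz_def
      by (auto dest!: spec[of _ 0] spec[of _ "[b]"])
    then show ?thesis by (auto simp: bdd_above_def iter_deriv_def)
  qed
  then obtain B where B: "\<And>b x. b \<in> Basis \<Longrightarrow> norm (dir_deriv \<Phi> b x) \<le> B b"
    by metis
  have B0: "0 \<le> B b" if "b \<in> Basis" for b
    using B[OF that, of 0] norm_ge_zero order_trans by blast
  have "norm (\<Phi> v - \<Phi> w) \<le> sum B Basis * norm (v - w)" for v w
  proof (rule differentiable_bound[of UNIV \<Phi> "\<lambda>x. frechet_derivative \<Phi> (at x)"])
    fix x :: 'a
    show "(\<Phi> has_derivative frechet_derivative \<Phi> (at x)) (at x within UNIV)"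
      using diff frechet_derivative_works by auto
    show "onorm (frechet_derivative \<Phi> (at x)) \<le> sum B Basis"
    proof (rule onorm_bound)
      fix h :: 'a
      have "norm (frechet_derivative \<Phi> (at x) h) \<le> (\<Sum>b\<in>Basis. \<bar>h \<bullet> b\<bar> * norm (dir_deriv \<Phi> b x))"
        unfolding frechet_derivative_dir_deriv[OF diff] by (rule order_trans[OF norm_sum]) simp
      also have "\<dots> \<le> (\<Sum>b\<in>Basis. norm h * B b)"
        by (intro sum_mono mult_mono B Basis_le_norm) auto
      finally show "norm (frechet_derivative \<Phi> (at x) h) \<le> sum B Basis * norm h"
        by (simp add: sum_distrib_left mult.commute)
    qed (simp add: sum_nonneg B0)
  qed auto
  with that[of "sum B Basis"] B0 show ?thesis by (simp add: sum_nonneg)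
qed

definition vertical_maximal ::
    "('a::euclidean_space \<Rightarrow> complex) \<Rightarrow> ('a \<Rightarrow> complex) \<Rightarrow> 'a \<Rightarrow> ennreal" where
  "vertical_maximal \<Phi> F x =
     (SUP t\<in>{0<..}. ennreal (norm (distr_convolution (regular_distribution F) (dilate \<Phi> t) x)))"

lemma hardy_norm_regular:
  "hardy_norm \<Phi> (regular_distribution F) = (\<integral>\<^sup>+x. vertical_maximal \<Phi> F x \<partial>lborel)"
  by (simp add: hardy_norm_def vertical_maximal_def)

lemma distr_convolution_regular:
  "distr_convolution (regular_distribution F) g x = (\<integral>y. F y * g (x - y) \<partial>lborel)"
  by (simp add: distr_convolution_def regular_distribution_def)

lemma continuous_on_distr_convolution:
  fixes F :: "'a::euclidean_space \<Rightarrow> complex"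
  assumes F: "integrable lborel F" and g: "continuous_on UNIV g"
    and bound: "\<And>v. norm (g v) \<le> C"
  shows "continuous_on UNIV (distr_convolution (regular_distribution F) g)"
proof (rule continuous_at_imp_continuous_on, intro ballI continuous_at_sequentiallyI)
  fix x and X :: "nat \<Rightarrow> 'a" assume X: "X \<longlonglongrightarrow> x"
  have [measurable]: "F \<in> borel_measurable borel" "g \<in> borel_measurable borel"
    using F g borel_measurable_continuous_onI by auto
  have "(\<lambda>n. \<integral>y. F y * g (X n - y) \<partial>lborel) \<longlonglongrightarrow> (\<integral>y. F y * g (x - y) \<partial>lborel)"
  proof (rule integral_dominated_convergence)
    show "integrable lborel (\<lambda>y. norm (F y) * C)"
      using F by simp
    show "AE y in lborel. norm (F y * g (X n - y)) \<le> norm (F y) * C" for n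
      by (auto simp: norm_mult intro!: mult_left_mono bound)
    show "AE y in lborel. (\<lambda>n. F y * g (X n - y)) \<longlonglongrightarrow> F y * g (x - y)"
      by (intro AE_I2 tendsto_intros X continuous_on_tendsto_compose[OF g]) auto
  qed measurable
  then show "(\<lambda>n. distr_convolution (regular_distribution F) g (X n))
      \<longlonglongrightarrow> distr_convolution (regular_distribution F) g x"
    by (simp add: distr_convolution_regular)
qed

text \<open>A supremum over uncountably many \<open>t\<close> need not be measurable in general; here every \<open>F * \<Phi>\<^sub>t\<close>
  is continuous, so the maximal function is lower semicontinuous.\<close>

lemma borel_measurable_vertical_maximal [measurable]:
  fixes F :: "'a::euclidean_space \<Rightarrow> complex"
  assumes F: "integrable lborel F" and \<Phi>: "\<Phi> \<in> schwartz"
  shows "vertical_maximal \<Phi> F \<in> borel_measurable borel"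
proof (rule borel_measurableI_greater)
  fix y
  obtain C where C: "0 \<le> C" "\<And>v. (1 + norm v) ^ 0 * norm (\<Phi> v) \<le> C"
    using schwartz_decay[OF \<Phi>, of 0] by blast
  have "open {x. y < ennreal (norm (distr_convolution (regular_distribution F) (dilate \<Phi> t) x))}"
    if "0 < t" for t
  proof (rule open_Collect_less)
    have "continuous_on UNIV (dilate \<Phi> t)"
      unfolding dilate_def
      by (intro continuous_intros continuous_on_compose2[OF schwartz_continuous[OF \<Phi>]]) auto
    moreover have "norm (dilate \<Phi> t v) \<le> 1 / t ^ DIM('a) * C" for v
      using C(2)[of "v /\<^sub>R t"] that by (simp add: dilate_def divide_right_mono)
    ultimately show "continuous_on UNIV
        (\<lambda>x. ennreal (norm (distr_convolution (regular_distribution F) (dilate \<Phi> t) x)))"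
      by (intro continuous_on_ennreal continuous_on_norm continuous_on_distr_convolution[OF F])
  qed auto
  then have "open (\<Union>t\<in>{0<..}.
      {x. y < ennreal (norm (distr_convolution (regular_distribution F) (dilate \<Phi> t) x))})"
    by auto
  moreover have "{x \<in> space borel. y < vertical_maximal \<Phi> F x} = (\<Union>t\<in>{0<..}.
      {x. y < ennreal (norm (distr_convolution (regular_distribution F) (dilate \<Phi> t) x))})"
    by (auto simp: vertical_maximal_def less_SUP_iff)
  ultimately show "{x \<in> space borel. y < vertical_maximal \<Phi> F x} \<in> sets borel"
    by simp
qed

lemma vertical_maximal_upper:
  "0 < t \<Longrightarrow> ennreal (norm (distr_convolution (regular_distribution F) (dilate \<Phi> t) x))
     \<le> vertical_maximal \<Phi> F x"
  unfolding vertical_maximal_def by (rule SUP_upper) simp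

text \<open>As \<open>t\<close> tends to \<open>0\<close>, \<open>F * \<Phi>\<^sub>t(x)\<close> tends to \<open>F(x)\<close>. Near \<open>x\<close> the function \<open>F\<close> is bounded and
  dominated convergence applies after rescaling. Away from \<open>x\<close> the function \<open>F\<close> is merely integrable,
  but there \<open>\<Phi>\<^sub>t\<close> is of size \<open>t\<close>, because \<open>\<Phi>\<close> decays faster than \<open>|v|\<^bsup>-(n+1)\<^esup>\<close>.\<close>

lemma norm_le_vertical_maximal:
  fixes F :: "'a::euclidean_space \<Rightarrow> complex"
  assumes F: "integrable lborel F" and \<Phi>: "\<Phi> \<in> schwartz" "integral\<^sup>L lborel \<Phi> = 1"
    and cont: "isCont F x"
  shows "ennreal (norm (F x)) \<le> vertical_maximal \<Phi> F x"
proof -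
  let ?n = "DIM('a)"
  define T where "T k = inverse (real (Suc k))" for k
  have T0: "0 < T k" for k by (simp add: T_def)
  have Tlim: "T \<longlonglongrightarrow> 0" unfolding T_def by (rule LIMSEQ_inverse_real_of_nat)
  have int\<Phi>: "integrable lborel \<Phi>"
    using \<Phi>(2) not_integrable_integral_eq by fastforce
  have [measurable]: "F \<in> borel_measurable borel" "\<Phi> \<in> borel_measurable borel"
    using F int\<Phi> borel_measurable_integrable by auto
  have [measurable]: "dilate \<Phi> t \<in> borel_measurable borel" for t
    unfolding dilate_def by measurable
  obtain C where C: "0 \<le> C" "\<And>v. (1 + norm v) ^ Suc ?n * norm (\<Phi> v) \<le> C"
    using schwartz_decay[OF \<Phi>(1), of "Suc ?n"] by blast
  obtain d where d: "0 < d" "\<And>y. dist y x < d \<Longrightarrow> dist (F y) (F x) < 1"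
    using cont[unfolded continuous_at_eps_delta, rule_format, of 1] by auto
  define F1 where "F1 y = indicator (ball x d) y *\<^sub>R F y" for y
  define F2 where "F2 y = indicator (- ball x d) y *\<^sub>R F y" for y
  have [measurable]: "F1 \<in> borel_measurable borel" "F2 \<in> borel_measurable borel"
    unfolding F1_def F2_def
    by (intro borel_measurable_scaleR borel_measurable_indicator; simp)+
  have F1_bound: "norm (F1 y) \<le> norm (F x) + 1" for y
  proof (cases "y \<in> ball x d")
    case True
    then have "dist (F y) (F x) < 1" using d(2)[of y] by (simp add: dist_commute)
    moreover have "norm (F y) \<le> norm (F x) + dist (F y) (F x)"
      by (simp add: dist_norm norm_triangle_sub)
    ultimately show ?thesis using True by (simp add: F1_def)
  qed (simp add: F1_def)
  have tail: "norm (dilate \<Phi> t v) \<le> C * t / d ^ Suc ?n" if t: "0 < t" and v: "d \<le> norm v" for t v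
  proof -
    have "(d / t) ^ Suc ?n * norm (\<Phi> (v /\<^sub>R t)) \<le> (1 + norm (v /\<^sub>R t)) ^ Suc ?n * norm (\<Phi> (v /\<^sub>R t))"
    proof (intro mult_right_mono power_mono)
      have "d / t \<le> norm v / t" using t v by (intro divide_right_mono) auto
      also have "\<dots> = norm (v /\<^sub>R t)" using t by (simp add: divide_inverse mult.commute)
      finally show "d / t \<le> 1 + norm (v /\<^sub>R t)" by simp
    qed (use t d(1) in auto)
    also have "\<dots> \<le> C" by (rule C(2))
    finally have "d ^ Suc ?n * norm (\<Phi> (v /\<^sub>R t)) \<le> C * t ^ Suc ?n"
      using t by (simp add: power_divide divide_le_eq)
    then have "norm (\<Phi> (v /\<^sub>R t)) \<le> C * t ^ Suc ?n / d ^ Suc ?n"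
      using d(1) by (simp add: le_divide_eq mult.commute del: power_Suc)
    then have "norm (\<Phi> (v /\<^sub>R t)) / t ^ ?n \<le> C * t ^ Suc ?n / d ^ Suc ?n / t ^ ?n"
      using t by (intro divide_right_mono) auto
    also have "\<dots> = C * t / d ^ Suc ?n" using t by simp
    finally show ?thesis using t by (simp add: dilate_def)
  qed
  have near: "(\<lambda>k. \<integral>y. F1 y * dilate \<Phi> (T k) (x - y) \<partial>lborel) \<longlonglongrightarrow> F x"
  proof -
    have "(\<integral>y. F1 y * dilate \<Phi> t (x - y) \<partial>lborel) = (\<integral>z. F1 (x - t *\<^sub>R z) * \<Phi> z \<partial>lborel)"
      if "0 < t" for t
      using that
      by (subst integral_lborel_affine[of _ "-t" x])
         (auto simp: dilate_def simp flip: integral_scaleR_right)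
    moreover have "(\<lambda>k. \<integral>z. F1 (x - T k *\<^sub>R z) * \<Phi> z \<partial>lborel) \<longlonglongrightarrow> (\<integral>z. F x * \<Phi> z \<partial>lborel)"
    proof (rule integral_dominated_convergence)
      show "integrable lborel (\<lambda>z. (norm (F x) + 1) * norm (\<Phi> z))"
        using int\<Phi> by simp
      show "AE z in lborel. norm (F1 (x - T k *\<^sub>R z) * \<Phi> z) \<le> (norm (F x) + 1) * norm (\<Phi> z)" for k
        by (auto simp: norm_mult intro!: mult_right_mono F1_bound)
      have "(\<lambda>k. F1 (x - T k *\<^sub>R z)) \<longlonglongrightarrow> F x" for z
      proof -
        have lim: "(\<lambda>k. x - T k *\<^sub>R z) \<longlonglongrightarrow> x"
          by (rule tendsto_eq_intros Tlim | simp)+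
        have "(\<lambda>k. F (x - T k *\<^sub>R z)) \<longlonglongrightarrow> F x"
          by (rule isCont_tendsto_compose[OF cont lim])
        moreover have "\<forall>\<^sub>F k in sequentially. x - T k *\<^sub>R z \<in> ball x d"
          by (rule topological_tendstoD[OF lim]) (use d(1) in auto)
        then have "\<forall>\<^sub>F k in sequentially. F (x - T k *\<^sub>R z) = F1 (x - T k *\<^sub>R z)"
          by eventually_elim (simp add: F1_def)
        ultimately show ?thesis
          by (rule Lim_transform_eventually)
      qed
      then show "AE z in lborel. (\<lambda>k. F1 (x - T k *\<^sub>R z) * \<Phi> z) \<longlonglongrightarrow> F x * \<Phi> z"
        by (intro AE_I2 tendsto_intros)
    qed measurable
    ultimately show ?thesis using T0 \<Phi>(2) by simp
  qed
  have far_bound: "norm (F2 y * dilate \<Phi> t (x - y)) \<le> norm (F y) * (C * t / d ^ Suc ?n)"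
    if "0 < t" for t y
  proof (cases "y \<in> ball x d")
    case False
    then have "d \<le> norm (x - y)" by (simp add: dist_norm)
    from mult_left_mono[OF tail[OF that this], of "norm (F y)"] show ?thesis
      using False by (simp add: F2_def norm_mult)
  qed (use C(1) d(1) that in \<open>auto simp: F2_def\<close>)
  have far_int: "integrable lborel (\<lambda>y. F2 y * dilate \<Phi> t (x - y))" if "0 < t" for t
    by (rule Bochner_Integration.integrable_bound[of _ "\<lambda>y. norm (F y) * (C * t / d ^ Suc ?n)"])
       (use far_bound[OF that] F C(1) d(1) that in \<open>auto intro!: AE_I2 order_trans[OF _ abs_ge_self]\<close>)
  have far: "(\<lambda>k. \<integral>y. F2 y * dilate \<Phi> (T k) (x - y) \<partial>lborel) \<longlonglongrightarrow> 0"
  proof (rule Lim_null_comparison)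
    show "\<forall>\<^sub>F k in sequentially. norm (\<integral>y. F2 y * dilate \<Phi> (T k) (x - y) \<partial>lborel)
        \<le> (\<integral>y. norm (F y) \<partial>lborel) * (C * T k / d ^ Suc ?n)"
    proof (intro always_eventually allI)
      fix k
      have "norm (\<integral>y. F2 y * dilate \<Phi> (T k) (x - y) \<partial>lborel)
          \<le> (\<integral>y. norm (F y) * (C * T k / d ^ Suc ?n) \<partial>lborel)"
        by (rule Bochner_Integration.integral_norm_bound_integral[OF far_int[OF T0]])
           (use F far_bound[OF T0] in auto)
      then show "norm (\<integral>y. F2 y * dilate \<Phi> (T k) (x - y) \<partial>lborel)
          \<le> (\<integral>y. norm (F y) \<partial>lborel) * (C * T k / d ^ Suc ?n)" by simp
    qed
    show "(\<lambda>k. (\<integral>y. norm (F y) \<partial>lborel) * (C * T k / d ^ Suc ?n)) \<longlonglongrightarrow> 0"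
      using d(1) by (auto intro!: tendsto_eq_intros Tlim)
  qed
  have near_int: "integrable lborel (\<lambda>y. F1 y * dilate \<Phi> t (x - y))" if t: "0 < t" for t
  proof (rule Bochner_Integration.integrable_bound[of _ "\<lambda>y. (norm (F x) + 1) * norm (dilate \<Phi> t (x - y))"])
    have "integrable lborel (\<lambda>y. \<Phi> (x /\<^sub>R t + (- inverse t) *\<^sub>R y))"
      using t by (intro integrable_lborel_affine int\<Phi>) auto
    then have "integrable lborel (\<lambda>y. dilate \<Phi> t (x - y))"
      unfolding dilate_def by (simp add: scaleR_diff_right)
    then show "integrable lborel (\<lambda>y. (norm (F x) + 1) * norm (dilate \<Phi> t (x - y)))" by simp
  qed (auto simp: norm_mult intro!: AE_I2 mult_right_mono order_trans[OF F1_bound])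
  have "distr_convolution (regular_distribution F) (dilate \<Phi> t) x
      = (\<integral>y. F1 y * dilate \<Phi> t (x - y) \<partial>lborel) + (\<integral>y. F2 y * dilate \<Phi> t (x - y) \<partial>lborel)"
    if "0 < t" for t
  proof -
    have "F y * dilate \<Phi> t (x - y) = F1 y * dilate \<Phi> t (x - y) + F2 y * dilate \<Phi> t (x - y)" for y
      by (simp add: F1_def F2_def indicator_def)
    then show ?thesis
      unfolding distr_convolution_regular
      using Bochner_Integration.integral_add[OF near_int[OF that] far_int[OF that]] by simp
  qed
  then have "(\<lambda>k. distr_convolution (regular_distribution F) (dilate \<Phi> (T k)) x) \<longlonglongrightarrow> F x"
    using tendsto_add[OF near far] T0 by simp
  then have "(\<lambda>k. ennreal (norm (distr_convolution (regular_distribution F) (dilate \<Phi> (T k)) x)))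
      \<longlonglongrightarrow> ennreal (norm (F x))"
    by (intro tendsto_ennrealI tendsto_norm)
  then show ?thesis
    by (rule LIMSEQ_le_const2) (auto intro!: exI[of _ 0] vertical_maximal_upper T0)
qed

section \<open>Pairing with kernels integrated over all scales\<close>

text \<open>Here and below \<open>ennreal (1 / r)\<close> is the density of the scale-invariant measure \<open>dr/r\<close> on
  \<open>r > 0\<close>: negative numbers are sent to \<open>0\<close> by \<^const>\<open>ennreal\<close> and \<open>1 / 0 = 0\<close>, so the weight
  vanishes for \<open>r \<le> 0\<close>. By Tonelli it suffices to bound the total mass of \<open>k(y/r)\<close> over all scales
  for one fixed \<open>y\<close>. The point \<open>y = 0\<close>, where that mass may be infinite, is a null set.\<close>

lemma nn_integral_scales_le:
  fixes g k :: "'a::euclidean_space \<Rightarrow> ennreal"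
  assumes [measurable]: "g \<in> borel_measurable borel" "k \<in> borel_measurable borel"
    and K: "\<And>y. y \<noteq> 0 \<Longrightarrow> (\<integral>\<^sup>+r. ennreal (1 / r) * k (y /\<^sub>R r) \<partial>lborel) \<le> K"
  shows "(\<integral>\<^sup>+r. ennreal (1 / r) * (\<integral>\<^sup>+y. g y * k (y /\<^sub>R r) \<partial>lborel) \<partial>lborel)
    \<le> K * (\<integral>\<^sup>+y. g y \<partial>lborel)"
proof -
  have "(\<integral>\<^sup>+r. ennreal (1 / r) * (\<integral>\<^sup>+y. g y * k (y /\<^sub>R r) \<partial>lborel) \<partial>lborel)
      = (\<integral>\<^sup>+r. (\<integral>\<^sup>+y. ennreal (1 / r) * (g y * k (y /\<^sub>R r)) \<partial>lborel) \<partial>lborel)"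
    by (simp add: nn_integral_cmult)
  also have "\<dots> = (\<integral>\<^sup>+y. (\<integral>\<^sup>+r. ennreal (1 / r) * (g y * k (y /\<^sub>R r)) \<partial>lborel) \<partial>lborel)"
    by (rule lborel_pair.Fubini') measurable
  also have "\<dots> = (\<integral>\<^sup>+y. g y * (\<integral>\<^sup>+r. ennreal (1 / r) * k (y /\<^sub>R r) \<partial>lborel) \<partial>lborel)"
    by (simp add: nn_integral_cmult mult.left_commute)
  also have "\<dots> \<le> (\<integral>\<^sup>+y. K * g y \<partial>lborel)"
  proof (rule nn_integral_mono_AE)
    show "AE y in lborel. g y * (\<integral>\<^sup>+r. ennreal (1 / r) * k (y /\<^sub>R r) \<partial>lborel) \<le> K * g y"
      using AE_lborel_singleton[of 0]
      by eventually_elim (use K in \<open>auto simp: mult.commute[of K] intro!: mult_left_mono\<close>)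
  qed
  also have "\<dots> = K * (\<integral>\<^sup>+y. g y \<partial>lborel)"
    by (rule nn_integral_cmult) simp
  finally show ?thesis .
qed

text \<open>The admissible radii form the interval from \<open>|y|/b\<close> to \<open>|y|/a\<close>, on which \<open>1/r \<le> b/|y|\<close>. The
  exact value is \<open>log (b/a)\<close>; any finite bound independent of \<open>y\<close> serves.\<close>

lemma nn_integral_scales_annulus:
  fixes y :: "'a::euclidean_space"
  assumes ab: "0 < a" "a < b" and y: "y \<noteq> 0"
  shows "(\<integral>\<^sup>+r. ennreal (1 / r) * indicator {z. a \<le> norm z \<and> norm z \<le> b} (y /\<^sub>R r) \<partial>lborel)
    \<le> ennreal (b / a)"
proof -
  have s: "0 < norm y" using y by simp
  have "ennreal (1 / r) * indicator {z. a \<le> norm z \<and> norm z \<le> b} (y /\<^sub>R r)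
      \<le> ennreal (b / norm y) * indicator {norm y / b..norm y / a} r" for r
  proof (cases "0 < r \<and> a \<le> norm (y /\<^sub>R r) \<and> norm (y /\<^sub>R r) \<le> b")
    case True
    then have r: "0 < r" "a * r \<le> norm y" "norm y \<le> b * r"
      by (auto simp: field_simps)
    then have "r \<in> {norm y / b..norm y / a}" "1 / r \<le> b / norm y"
      using ab s by (auto simp: field_simps)
    then show ?thesis by (auto simp: indicator_def intro!: ennreal_leI)
  next
    case False
    then have "ennreal (1 / r) * indicator {z. a \<le> norm z \<and> norm z \<le> b} (y /\<^sub>R r) = 0"
      by (cases "0 < r") (auto simp: indicator_def ennreal_neg)
    then show ?thesis by (simp only: zero_le)
  qed
  then have "(\<integral>\<^sup>+r. ennreal (1 / r) * indicator {z. a \<le> norm z \<and> norm z \<le> b} (y /\<^sub>R r) \<partial>lborel)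
      \<le> (\<integral>\<^sup>+r. ennreal (b / norm y) * indicator {norm y / b..norm y / a} r \<partial>lborel)"
    by (rule nn_integral_mono)
  also have "\<dots> = ennreal (b / norm y) * ennreal (norm y / a - norm y / b)"
    using ab s by (subst nn_integral_cmult_indicator) (auto simp: frac_le)
  also have "\<dots> = ennreal (b / norm y * (norm y / a - norm y / b))"
    using ab s by (intro ennreal_mult'[symmetric]) auto
  also have "\<dots> \<le> ennreal (b / a)"
    using ab s by (intro ennreal_leI) (auto simp: field_simps)
  finally show ?thesis .
qed

text \<open>With \<open>s = |y|\<close>, the two hypotheses give \<open>k(y/r) \<le> B r/s\<close> for \<open>r \<le> s\<close> and
  \<open>k(y/r) \<le> B s/r\<close> for \<open>r \<ge> s\<close>; each half contributes at most \<open>B\<close>.\<close>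

lemma nn_integral_scales_decay:
  fixes k :: "'a::euclidean_space \<Rightarrow> real" and y :: 'a
  assumes k: "\<And>w. k w \<le> B * norm w" "\<And>w. norm w * k w \<le> B" and B: "0 \<le> B" and y: "y \<noteq> 0"
  shows "(\<integral>\<^sup>+r. ennreal (1 / r) * ennreal (k (y /\<^sub>R r)) \<partial>lborel) \<le> ennreal (2 * B)"
proof -
  define s where "s = norm y"
  have s: "0 < s" using y by (simp add: s_def)
  have "ennreal (1 / r) * ennreal (k (y /\<^sub>R r))
      \<le> ennreal (B / s) * indicator {0..s} r + ennreal (B * s / r\<^sup>2) * indicator {s..} r" for r
  proof (cases "0 < r")
    case r: True
    have nw: "norm (y /\<^sub>R r) = s / r" using r by (simp add: s_def divide_inverse mult.commute)
    have "ennreal (1 / r) * ennreal (k (y /\<^sub>R r)) = ennreal (1 / r * k (y /\<^sub>R r))"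
      using r by (intro ennreal_mult'[symmetric]) auto
    moreover have "1 / r * k (y /\<^sub>R r) \<le> B / s"
      using k(2)[of "y /\<^sub>R r"] r s unfolding nw by (simp add: field_simps)
    moreover have "1 / r * k (y /\<^sub>R r) \<le> B * s / r\<^sup>2"
      using k(1)[of "y /\<^sub>R r"] r s unfolding nw by (simp add: field_simps power2_eq_square)
    ultimately show ?thesis
      using r by (cases "r \<le> s") (auto simp: indicator_def intro: ennreal_leI add_increasing2)
  qed (simp add: ennreal_neg)
  then have "(\<integral>\<^sup>+r. ennreal (1 / r) * ennreal (k (y /\<^sub>R r)) \<partial>lborel)
      \<le> (\<integral>\<^sup>+r. ennreal (B / s) * indicator {0..s} r + ennreal (B * s / r\<^sup>2) * indicator {s..} r \<partial>lborel)"
    by (rule nn_integral_mono)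
  also have "\<dots> = ennreal (B / s) * ennreal s + (\<integral>\<^sup>+r. ennreal (B * s / r\<^sup>2) * indicator {s..} r \<partial>lborel)"
    using s by (subst nn_integral_add) (auto simp: nn_integral_cmult_indicator)
  also have "(\<integral>\<^sup>+r. ennreal (B * s / r\<^sup>2) * indicator {s..} r \<partial>lborel) = ennreal (0 - (- (B * s / s)))"
  proof (rule nn_integral_FTC_atLeast[where F = "\<lambda>r. - (B * s / r)" and T = 0])
    show "DERIV (\<lambda>r. - (B * s / r)) r :> B * s / r\<^sup>2" if "s \<le> r" for r
      using that s by (auto intro!: derivative_eq_intros simp: power2_eq_square)
    show "((\<lambda>r. - (B * s / r)) \<longlongrightarrow> 0) at_top"
      by (rule tendsto_eq_intros tendsto_divide_0[OF tendsto_const] filterlim_at_top_imp_at_infinity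
          filterlim_ident | simp)+
  qed (use B s in auto)
  also have "ennreal (B / s) * ennreal s + ennreal (0 - (- (B * s / s))) = ennreal (2 * B)"
    using B s by (simp add: ennreal_mult'[symmetric] ennreal_plus[symmetric] del: ennreal_plus)
  finally show ?thesis .
qed

text \<open>The annuli exhaust the punctured space, so the integrals over them converge to the integral
  over the whole space. The annulus has to avoid the origin and infinity for the bound on
  \<open>\<integral> dr/r\<close> above to be finite.\<close>

lemma annulus_integral_nonzero:
  fixes \<Phi> :: "'a::euclidean_space \<Rightarrow> complex"
  assumes "integral\<^sup>L lborel \<Phi> \<noteq> 0"
  obtains a b where "0 < a" "a < b"
    "(\<integral>z. indicator {z. a \<le> norm z \<and> norm z \<le> b} z *\<^sub>R \<Phi> z \<partial>lborel) \<noteq> 0"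
proof -
  have int: "integrable lborel \<Phi>"
    using assms not_integrable_integral_eq by blast
  then have [measurable]: "\<Phi> \<in> borel_measurable borel"
    using borel_measurable_integrable by auto
  define A where "A n = {z::'a. inverse (real (Suc n)) \<le> norm z \<and> norm z \<le> real n + 2}" for n
  have A [measurable]: "A n \<in> sets borel" for n
    unfolding A_def by measurable
  have "(\<lambda>n. \<integral>z. indicator (A n) z *\<^sub>R \<Phi> z \<partial>lborel) \<longlonglongrightarrow> integral\<^sup>L lborel \<Phi>"
  proof (rule integral_dominated_convergence)
    show "integrable lborel (\<lambda>z. norm (\<Phi> z))" using int by simp
    show "AE z in lborel. norm (indicator (A n) z *\<^sub>R \<Phi> z) \<le> norm (\<Phi> z)" for n
      by (auto simp: indicator_def)
    have ev: "\<forall>\<^sub>F n in sequentially. indicator (A n) z *\<^sub>R \<Phi> z = \<Phi> z" if "z \<noteq> 0" for z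
    proof -
      have "\<forall>\<^sub>F n in sequentially. inverse (real (Suc n)) < norm z"
        using order_tendstoD(2)[OF LIMSEQ_inverse_real_of_nat, of "norm z"] that by simp
      moreover have "\<forall>\<^sub>F n in sequentially. norm z \<le> real n"
        using filterlim_at_top[of real sequentially] filterlim_real_sequentially by blast
      ultimately show ?thesis
        by eventually_elim (auto simp: A_def)
    qed
    show "AE z in lborel. (\<lambda>n. indicator (A n) z *\<^sub>R \<Phi> z) \<longlonglongrightarrow> \<Phi> z"
      using AE_lborel_singleton[of 0]
      by eventually_elim (use ev in \<open>auto intro!: tendsto_eventually\<close>)
  qed measurable
  then have "\<forall>\<^sub>F n in sequentially. (\<integral>z. indicator (A n) z *\<^sub>R \<Phi> z \<partial>lborel) \<noteq> 0"
    by (rule tendsto_imp_eventually_ne) (use assms in auto)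
  then obtain n where n: "(\<integral>z. indicator (A n) z *\<^sub>R \<Phi> z \<partial>lborel) \<noteq> 0"
    using eventually_happens'[OF sequentially_bot] by blast
  show ?thesis
  proof (rule that[of "inverse (real (Suc n))" "real n + 2"])
    have "inverse (real (Suc n)) \<le> 1" by (simp add: inverse_le_1_iff)
    then show "inverse (real (Suc n)) < real n + 2" by linarith
  qed (use n in \<open>auto simp: A_def\<close>)
qed

lemma nn_integral_lborel_shift:
  fixes f :: "'a::euclidean_space \<Rightarrow> ennreal"
  assumes "f \<in> borel_measurable borel"
  shows "(\<integral>\<^sup>+y. f (x + y) \<partial>lborel) = (\<integral>\<^sup>+y. f y \<partial>lborel)"
  using nn_integral_lborel_affine[OF assms, of 1 x] by simp

text \<open>The pairing of \<open>F\<close> with \<open>\<integral> \<omega>(y/r) dr/r\<close>, a kernel with a logarithmic singularity at the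
  origin and at infinity. The proof subtracts from \<open>\<omega>\<close> the multiple of an average \<open>\<psi>\<close> of translates
  of \<open>\<Phi>\<close> that has the same value at the origin. The average is paired with \<open>F\<close> through the maximal
  function, and the remainder has no singularity and is paired with \<open>F\<close> in \<open>L\<^sup>1\<close>.\<close>

lemma hardy_multiscale_bound:
  fixes \<Phi> :: "'a::euclidean_space \<Rightarrow> complex" and \<omega> :: "'a \<Rightarrow> real"
  assumes \<Phi>: "\<Phi> \<in> schwartz" "integral\<^sup>L lborel \<Phi> = 1"
    and \<omega>[measurable]: "\<omega> \<in> borel_measurable borel"
    and \<omega>_lip: "\<And>w. \<bar>\<omega> w - \<omega> 0\<bar> \<le> A * norm w" and \<omega>_decay: "\<And>w. norm w * \<bar>\<omega> w\<bar> \<le> A"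
  obtains C where "0 < C"
    "\<And>F x. \<lbrakk>integrable lborel F; AE y in lborel. ennreal (norm (F y)) \<le> vertical_maximal \<Phi> F y\<rbrakk> \<Longrightarrow>
      (\<integral>\<^sup>+r. ennreal (1 / r) * ennreal (norm (\<integral>y. F (x + y) * complex_of_real (\<omega> (y /\<^sub>R r)) \<partial>lborel)) \<partial>lborel)
        \<le> ennreal C * hardy_norm \<Phi> (regular_distribution F)"
proof -
  let ?n = "DIM('a)"
  obtain C0 where C0: "0 \<le> C0" "\<And>v. (1 + norm v) ^ 1 * norm (\<Phi> v) \<le> C0"
    using schwartz_decay[OF \<Phi>(1), of 1] by blast
  have \<Phi>_le: "norm (\<Phi> v) \<le> C0" for v
    using C0(2)[of v] mult_right_mono[of 1 "1 + norm v" "norm (\<Phi> v)"] by simp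
  obtain L where L: "0 \<le> L" "\<And>v w. norm (\<Phi> v - \<Phi> w) \<le> L * norm (v - w)"
    using schwartz_lipschitz[OF \<Phi>(1)] by blast
  have [measurable]: "\<Phi> \<in> borel_measurable borel"
    by (rule borel_measurable_continuous_onI[OF schwartz_continuous[OF \<Phi>(1)]])
  obtain a b where ab: "0 < a" "a < b"
    and nz: "(\<integral>z. indicator {z. a \<le> norm z \<and> norm z \<le> b} z *\<^sub>R \<Phi> z \<partial>lborel) \<noteq> 0"
    using annulus_integral_nonzero[of \<Phi>] \<Phi>(2) by auto
  define Ann :: "'a set" where "Ann = {z. a \<le> norm z \<and> norm z \<le> b}"
  have Ann [measurable]: "Ann \<in> sets borel"
    unfolding Ann_def by measurable
  have "emeasure lborel Ann \<le> emeasure lborel (cball (0::'a) b)"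
    by (intro emeasure_mono) (auto simp: Ann_def)
  then have Ann_fin: "emeasure lborel Ann < \<infinity>"
    using emeasure_lborel_cball_finite[of "0::'a" b] by (auto simp: less_top[symmetric] top_unique)
  define E where "E = measure lborel Ann"
  have E0: "0 \<le> E" by (simp add: E_def)
  have intAnn: "integrable lborel (indicator Ann :: 'a \<Rightarrow> real)"
    using Ann_fin by simp
  have intE: "(\<integral>z. indicator Ann z \<partial>lborel) = E"
    by (simp add: E_def)

  define \<psi> where "\<psi> w = (\<integral>z. indicator Ann z *\<^sub>R \<Phi> (z - w) \<partial>lborel)" for w
  define m where "m = \<psi> 0"
  have m0: "m \<noteq> 0" using nz by (simp add: m_def \<psi>_def Ann_def)
  have [measurable]: "\<psi> \<in> borel_measurable borel"
    unfolding \<psi>_def by measurable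
  have int\<psi>: "integrable lborel (\<lambda>z. indicator Ann z *\<^sub>R \<Phi> (z - w))" for w
  proof (rule Bochner_Integration.integrable_bound[of _ "\<lambda>z. indicator Ann z * C0"])
    show "integrable lborel (\<lambda>z. indicator Ann z * C0)" using intAnn by simp
  qed (use \<Phi>_le C0(1) in \<open>auto simp: indicator_def\<close>)
  have \<psi>_lip: "norm (\<psi> w - \<psi> 0) \<le> L * E * norm w" for w
  proof -
    have "\<psi> w - \<psi> 0 = (\<integral>z. indicator Ann z *\<^sub>R (\<Phi> (z - w) - \<Phi> z) \<partial>lborel)"
      unfolding \<psi>_def using int\<psi>[of w] int\<psi>[of 0]
      by (simp add: scaleR_diff_right)
    also have "norm \<dots> \<le> (\<integral>z. indicator Ann z * (L * norm w) \<partial>lborel)"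
    proof (rule Bochner_Integration.integral_norm_bound_integral)
      show "norm (indicator Ann z *\<^sub>R (\<Phi> (z - w) - \<Phi> z)) \<le> indicator Ann z * (L * norm w)" for z
        using L(2)[of "z - w" z] by (simp add: indicator_def)
      show "integrable lborel (\<lambda>z. indicator Ann z * (L * norm w))"
        using intAnn by (rule Bochner_Integration.integrable_mult_left)
      show "integrable lborel (\<lambda>z. indicator Ann z *\<^sub>R (\<Phi> (z - w) - \<Phi> z))"
        using Bochner_Integration.integrable_diff[OF int\<psi>[of w] int\<psi>[of 0]] by (simp add: scaleR_diff_right)
    qed
    finally show ?thesis by (simp add: E_def mult_ac)
  qed
  have \<psi>_decay: "norm w * norm (\<psi> w) \<le> C0 * (1 + b) * E" for w
  proof -
    have pt: "norm (norm w *\<^sub>R (indicator Ann z *\<^sub>R \<Phi> (z - w))) \<le> indicator Ann z * (C0 * (1 + b))" for z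
    proof (cases "z \<in> Ann")
      case True
      then have z: "norm z \<le> b" by (simp add: Ann_def)
      have "0 \<le> b * norm (z - w)" using ab by simp
      have "norm w \<le> norm z + norm (z - w)"
        using norm_triangle_ineq4[of z "z - w"] by simp
      also have "\<dots> \<le> (1 + norm (z - w)) * (1 + b)"
        using z \<open>0 \<le> b * norm (z - w)\<close> by (simp add: algebra_simps)
      finally have "norm w * norm (\<Phi> (z - w)) \<le> (1 + norm (z - w)) * (1 + b) * norm (\<Phi> (z - w))"
        by (rule mult_right_mono) simp
      also have "\<dots> \<le> C0 * (1 + b)"
        using mult_right_mono[OF C0(2)[of "z - w"], of "1 + b"] ab by (simp add: mult_ac)
      finally show ?thesis using True by simp
    qed simp
    have "norm w * norm (\<psi> w) = norm (\<integral>z. norm w *\<^sub>R (indicator Ann z *\<^sub>R \<Phi> (z - w)) \<partial>lborel)"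
      by (simp only: \<psi>_def integral_scaleR_right norm_scaleR abs_norm_cancel)
    also have "\<dots> \<le> (\<integral>z. indicator Ann z * (C0 * (1 + b)) \<partial>lborel)"
      by (rule Bochner_Integration.integral_norm_bound_integral[OF
            integrable_scaleR_right[OF int\<psi>] integrable_mult_left[OF intAnn] pt])
    finally show ?thesis by (simp add: E_def mult_ac)
  qed

  \<comment> \<open>The multiple \<open>\<kappa>\<close> is chosen to make \<open>\<rho>\<close> vanish at the origin.\<close>
  define \<kappa> where "\<kappa> = complex_of_real (\<omega> 0) / m"
  have \<kappa>m: "\<kappa> * m = complex_of_real (\<omega> 0)"
    using m0 by (simp add: \<kappa>_def)
  define \<rho> where "\<rho> w = complex_of_real (\<omega> w) - \<kappa> * \<psi> w" for w
  have [measurable]: "\<rho> \<in> borel_measurable borel" unfolding \<rho>_def by measurable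
  have A0: "0 \<le> A" using \<omega>_decay[of 0] by simp
  define B where "B = A + norm \<kappa> * (L * E) + norm \<kappa> * (C0 * (1 + b) * E)"
  have B0: "0 \<le> B" using A0 L(1) E0 C0(1) ab by (simp add: B_def)
  have \<rho>_lip: "norm (\<rho> w) \<le> B * norm w" for w
  proof -
    have "\<rho> w = complex_of_real (\<omega> w - \<omega> 0) - \<kappa> * (\<psi> w - \<psi> 0)"
      using \<kappa>m by (simp add: \<rho>_def right_diff_distrib flip: m_def)
    also have "norm \<dots> \<le> \<bar>\<omega> w - \<omega> 0\<bar> + norm \<kappa> * norm (\<psi> w - \<psi> 0)"
      using norm_triangle_ineq4[of "complex_of_real (\<omega> w - \<omega> 0)" "\<kappa> * (\<psi> w - \<psi> 0)"]
      by (simp add: norm_mult del: of_real_diff)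
    also have "\<dots> \<le> A * norm w + norm \<kappa> * (L * E * norm w)"
      by (intro add_mono \<omega>_lip mult_left_mono \<psi>_lip) simp
    also have "\<dots> \<le> B * norm w"
      using C0(1) ab E0 by (simp add: B_def algebra_simps)
    finally show ?thesis .
  qed
  have \<rho>_decay: "norm w * norm (\<rho> w) \<le> B" for w
  proof -
    have "norm (\<rho> w) \<le> \<bar>\<omega> w\<bar> + norm \<kappa> * norm (\<psi> w)"
      using norm_triangle_ineq4[of "complex_of_real (\<omega> w)" "\<kappa> * \<psi> w"]
      by (simp add: \<rho>_def norm_mult)
    then have "norm w * norm (\<rho> w) \<le> norm w * (\<bar>\<omega> w\<bar> + norm \<kappa> * norm (\<psi> w))"
      by (rule mult_left_mono) simp
    also have "\<dots> = norm w * \<bar>\<omega> w\<bar> + norm \<kappa> * (norm w * norm (\<psi> w))"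
      by (simp add: algebra_simps)
    also have "\<dots> \<le> A + norm \<kappa> * (C0 * (1 + b) * E)"
      by (intro add_mono \<omega>_decay mult_left_mono \<psi>_decay) simp
    also have "\<dots> \<le> B" using L(1) E0 by (simp add: B_def)
    finally show ?thesis .
  qed
  have \<rho>_le: "norm (\<rho> w) \<le> B" for w
  proof (cases "norm w \<le> 1")
    case True
    then show ?thesis using \<rho>_lip[of w] mult_left_mono[OF True B0] by simp
  next
    case False
    then show ?thesis
      using \<rho>_decay[of w] mult_right_mono[of 1 "norm w" "norm (\<rho> w)"] by simp
  qed
  have \<psi>_le: "norm (\<psi> w) \<le> C0 * E" for w
  proof -
    have "norm (\<psi> w) \<le> (\<integral>z. indicator Ann z * C0 \<partial>lborel)"
      unfolding \<psi>_def
      by (rule Bochner_Integration.integral_norm_bound_integral[OF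
            int\<psi> integrable_mult_left[OF intAnn]])
         (simp add: indicator_def \<Phi>_le)
    then show ?thesis by (simp add: E_def mult_ac)
  qed

  define C where "C = 2 * B + norm \<kappa> * (b / a) + 1"
  have C_pos: "0 < C" using B0 ab by (simp add: C_def add_nonneg_pos)
  show ?thesis
  proof (rule that[OF C_pos])
    fix F x
    assume F: "integrable lborel F"
      and FM: "AE y in lborel. ennreal (norm (F y)) \<le> vertical_maximal \<Phi> F y"
    define M where "M = vertical_maximal \<Phi> F"
    have [measurable]: "M \<in> borel_measurable borel"
      unfolding M_def by (rule borel_measurable_vertical_maximal[OF F \<Phi>(1)])
    have [measurable]: "F \<in> borel_measurable borel"
      using F borel_measurable_integrable by auto
    have Fx: "integrable lborel (\<lambda>y. F (x + y))"
      using integrable_lborel_affine[OF F, of 1 x] by simp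
    have int_bounded: "integrable lborel (\<lambda>y. F (x + y) * h y)"
      if [measurable]: "h \<in> borel_measurable borel" and "\<And>y. norm (h y) \<le> D" for h :: "'a \<Rightarrow> complex" and D
      by (rule Bochner_Integration.integrable_bound[of _ "\<lambda>y. norm (F (x + y)) * D"])
         (use Fx that(2) order_trans[OF norm_ge_zero that(2)] in
           \<open>auto simp: norm_mult intro!: AE_I2 mult_left_mono\<close>)
    \<comment> \<open>The maximal function enters here: \<open>\<integral> F(x + y) \<Phi>(z - y/r) dy\<close> is \<open>r\<^sup>n (F * \<Phi>\<^sub>r)(x + r z)\<close>.\<close>
    have average: "ennreal (norm (\<integral>y. F (x + y) * \<psi> (y /\<^sub>R r) \<partial>lborel))
        \<le> (\<integral>\<^sup>+v. M (x + v) * indicator Ann (v /\<^sub>R r) \<partial>lborel)" if r: "0 < r" for r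
    proof -
      define G where "G z = (\<integral>y. F (x + y) * \<Phi> (z - y /\<^sub>R r) \<partial>lborel)" for z
      have conv: "G z = of_real (r ^ ?n) *
          distr_convolution (regular_distribution F) (dilate \<Phi> r) (x + r *\<^sub>R z)" for z
      proof -
        have [measurable]: "dilate \<Phi> r \<in> borel_measurable borel"
          unfolding dilate_def by measurable
        have "(\<integral>y. F y * dilate \<Phi> r (x + r *\<^sub>R z - y) \<partial>lborel)
            = (\<integral>y. F (x + y) * dilate \<Phi> r (r *\<^sub>R z - y) \<partial>lborel)"
          by (subst integral_lborel_affine[of _ 1 x]) auto
        also have "\<dots> = (\<integral>y. (1 / r ^ ?n) *\<^sub>R (F (x + y) * \<Phi> (z - y /\<^sub>R r)) \<partial>lborel)"
          using r by (simp add: dilate_def scaleR_diff_right)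
        also have "\<dots> = (1 / r ^ ?n) *\<^sub>R G z"
          by (simp add: G_def)
        finally show ?thesis
          using r by (simp add: distr_convolution_regular scaleR_conv_of_real)
      qed
      have int2: "integrable (lborel \<Otimes>\<^sub>M lborel)
          (\<lambda>(y, z). indicator Ann z *\<^sub>R (F (x + y) * \<Phi> (z - y /\<^sub>R r)))"
      proof (rule Bochner_Integration.integrable_bound)
        show "integrable (lborel \<Otimes>\<^sub>M lborel) (\<lambda>(y, z). indicator Ann z * (norm (F (x + y)) * C0))"
          by (rule lborel_pair.Fubini_integrable)
             (use Fx intAnn C0(1) in \<open>auto simp: abs_mult intE\<close>)
        show "AE p in lborel \<Otimes>\<^sub>M lborel.
            norm (case p of (y, z) \<Rightarrow> indicator Ann z *\<^sub>R (F (x + y) * \<Phi> (z - y /\<^sub>R r)))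
            \<le> norm (case p of (y, z) \<Rightarrow> indicator Ann z * (norm (F (x + y)) * C0))"
          using C0(1) by (auto simp: norm_mult abs_mult indicator_def intro!: AE_I2 mult_left_mono \<Phi>_le)
      qed measurable
      have "(\<integral>y. F (x + y) * \<psi> (y /\<^sub>R r) \<partial>lborel)
          = (\<integral>y. (\<integral>z. indicator Ann z *\<^sub>R (F (x + y) * \<Phi> (z - y /\<^sub>R r)) \<partial>lborel) \<partial>lborel)"
        unfolding \<psi>_def by (simp flip: integral_mult_right_zero mult_scaleR_right)
      also have "\<dots> = (\<integral>z. (\<integral>y. indicator Ann z *\<^sub>R (F (x + y) * \<Phi> (z - y /\<^sub>R r)) \<partial>lborel) \<partial>lborel)"
        by (rule lborel_pair.Fubini_integral[OF int2, symmetric])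
      also have "\<dots> = (\<integral>z. indicator Ann z *\<^sub>R G z \<partial>lborel)"
        by (simp add: G_def)
      finally have eq: "(\<integral>y. F (x + y) * \<psi> (y /\<^sub>R r) \<partial>lborel) = (\<integral>z. indicator Ann z *\<^sub>R G z \<partial>lborel)" .
      have "integrable lborel (\<lambda>z. \<integral>y. indicator Ann z *\<^sub>R (F (x + y) * \<Phi> (z - y /\<^sub>R r)) \<partial>lborel)"
        by (rule lborel_pair.integrable_snd[OF int2])
      then have "integrable lborel (\<lambda>z. indicator Ann z *\<^sub>R G z)"
        by (simp add: G_def)
      from integral_norm_bound_ennreal[OF this]
      have "ennreal (norm (\<integral>y. F (x + y) * \<psi> (y /\<^sub>R r) \<partial>lborel))
          \<le> (\<integral>\<^sup>+z. ennreal (norm (indicator Ann z *\<^sub>R G z)) \<partial>lborel)"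
        by (simp add: eq)
      also have "\<dots> \<le> (\<integral>\<^sup>+z. ennreal (r ^ ?n) * (M (x + r *\<^sub>R z) * indicator Ann z) \<partial>lborel)"
      proof (rule nn_integral_mono)
        fix z
        have "ennreal (norm (G z)) \<le> ennreal (r ^ ?n) * M (x + r *\<^sub>R z)"
          unfolding conv M_def norm_mult norm_of_real using r
          by (simp only: abs_of_nonneg zero_le_power less_imp_le ennreal_mult norm_ge_zero)
             (intro mult_left_mono vertical_maximal_upper zero_le)
        then show "ennreal (norm (indicator Ann z *\<^sub>R G z))
            \<le> ennreal (r ^ ?n) * (M (x + r *\<^sub>R z) * indicator Ann z)"
          by (auto simp: indicator_def)
      qed
      also have "\<dots> = ennreal (r ^ ?n) * (\<integral>\<^sup>+z. M (x + r *\<^sub>R z) * indicator Ann z \<partial>lborel)"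
        by (rule nn_integral_cmult) simp
      also have "\<dots> = (\<integral>\<^sup>+v. M (x + v) * indicator Ann (v /\<^sub>R r) \<partial>lborel)"
        using r by (subst nn_integral_lborel_affine[of "\<lambda>v. M (x + v) * indicator Ann (v /\<^sub>R r)" r 0]) auto
      finally show ?thesis .
    qed
    \<comment> \<open>At a single scale: \<open>\<omega> = \<rho> + \<kappa> \<psi>\<close>.\<close>
    have split: "ennreal (1 / r) * ennreal (norm (\<integral>y. F (x + y) * complex_of_real (\<omega> (y /\<^sub>R r)) \<partial>lborel))
        \<le> ennreal (1 / r) * (\<integral>\<^sup>+y. ennreal (norm (F (x + y))) * ennreal (norm (\<rho> (y /\<^sub>R r))) \<partial>lborel)
        + ennreal (norm \<kappa>) * (ennreal (1 / r) * (\<integral>\<^sup>+v. M (x + v) * indicator Ann (v /\<^sub>R r) \<partial>lborel))" for r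
    proof (cases "0 < r")
      case r: True
      have int\<rho>: "integrable lborel (\<lambda>y. F (x + y) * \<rho> (y /\<^sub>R r))"
        by (rule int_bounded[OF _ \<rho>_le]) simp
      have int\<psi>': "integrable lborel (\<lambda>y. F (x + y) * \<psi> (y /\<^sub>R r))"
        by (rule int_bounded[OF _ \<psi>_le]) simp
      have "F (x + y) * complex_of_real (\<omega> (y /\<^sub>R r))
          = F (x + y) * \<rho> (y /\<^sub>R r) + \<kappa> * (F (x + y) * \<psi> (y /\<^sub>R r))" for y
        by (simp add: \<rho>_def algebra_simps)
      then have "(\<integral>y. F (x + y) * complex_of_real (\<omega> (y /\<^sub>R r)) \<partial>lborel)
          = (\<integral>y. F (x + y) * \<rho> (y /\<^sub>R r) \<partial>lborel) + \<kappa> * (\<integral>y. F (x + y) * \<psi> (y /\<^sub>R r) \<partial>lborel)"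
        using int\<rho> int\<psi>' by simp
      then have "norm (\<integral>y. F (x + y) * complex_of_real (\<omega> (y /\<^sub>R r)) \<partial>lborel)
          \<le> norm (\<integral>y. F (x + y) * \<rho> (y /\<^sub>R r) \<partial>lborel)
            + norm \<kappa> * norm (\<integral>y. F (x + y) * \<psi> (y /\<^sub>R r) \<partial>lborel)"
        using norm_triangle_ineq[of "\<integral>y. F (x + y) * \<rho> (y /\<^sub>R r) \<partial>lborel"
            "\<kappa> * (\<integral>y. F (x + y) * \<psi> (y /\<^sub>R r) \<partial>lborel)"]
        by (simp only: norm_mult)
      then have "ennreal (norm (\<integral>y. F (x + y) * complex_of_real (\<omega> (y /\<^sub>R r)) \<partial>lborel))
          \<le> ennreal (norm (\<integral>y. F (x + y) * \<rho> (y /\<^sub>R r) \<partial>lborel))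
            + ennreal (norm \<kappa>) * ennreal (norm (\<integral>y. F (x + y) * \<psi> (y /\<^sub>R r) \<partial>lborel))"
        by (simp add: ennreal_leI flip: ennreal_plus ennreal_mult)
      also have "\<dots> \<le> (\<integral>\<^sup>+y. ennreal (norm (F (x + y))) * ennreal (norm (\<rho> (y /\<^sub>R r))) \<partial>lborel)
            + ennreal (norm \<kappa>) * (\<integral>\<^sup>+v. M (x + v) * indicator Ann (v /\<^sub>R r) \<partial>lborel)"
      proof (intro add_mono mult_left_mono average[OF r])
        show "ennreal (norm (\<integral>y. F (x + y) * \<rho> (y /\<^sub>R r) \<partial>lborel))
            \<le> (\<integral>\<^sup>+y. ennreal (norm (F (x + y))) * ennreal (norm (\<rho> (y /\<^sub>R r))) \<partial>lborel)"
          using integral_norm_bound_ennreal[OF int\<rho>] by (simp add: norm_mult ennreal_mult)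
      qed simp
      finally have "ennreal (1 / r) * ennreal (norm (\<integral>y. F (x + y) * complex_of_real (\<omega> (y /\<^sub>R r)) \<partial>lborel))
          \<le> ennreal (1 / r) * ((\<integral>\<^sup>+y. ennreal (norm (F (x + y))) * ennreal (norm (\<rho> (y /\<^sub>R r))) \<partial>lborel)
            + ennreal (norm \<kappa>) * (\<integral>\<^sup>+v. M (x + v) * indicator Ann (v /\<^sub>R r) \<partial>lborel))"
        by (rule mult_left_mono) simp
      then show ?thesis by (simp add: distrib_left mult.left_commute)
    qed (simp add: ennreal_neg)
    have "(\<integral>\<^sup>+r. ennreal (1 / r) * ennreal (norm (\<integral>y. F (x + y) * complex_of_real (\<omega> (y /\<^sub>R r)) \<partial>lborel)) \<partial>lborel)
        \<le> (\<integral>\<^sup>+r. ennreal (1 / r) * (\<integral>\<^sup>+y. ennreal (norm (F (x + y))) * ennreal (norm (\<rho> (y /\<^sub>R r))) \<partial>lborel)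
          + ennreal (norm \<kappa>) * (ennreal (1 / r) * (\<integral>\<^sup>+v. M (x + v) * indicator Ann (v /\<^sub>R r) \<partial>lborel)) \<partial>lborel)"
      by (rule nn_integral_mono) (rule split)
    also have "\<dots> = (\<integral>\<^sup>+r. ennreal (1 / r) * (\<integral>\<^sup>+y. ennreal (norm (F (x + y))) * ennreal (norm (\<rho> (y /\<^sub>R r))) \<partial>lborel) \<partial>lborel)
        + ennreal (norm \<kappa>) * (\<integral>\<^sup>+r. ennreal (1 / r) * (\<integral>\<^sup>+v. M (x + v) * indicator Ann (v /\<^sub>R r) \<partial>lborel) \<partial>lborel)"
      by (subst nn_integral_add, measurable, subst nn_integral_cmult) auto
    also have "\<dots> \<le> ennreal (2 * B) * (\<integral>\<^sup>+y. ennreal (norm (F (x + y))) \<partial>lborel)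
        + ennreal (norm \<kappa>) * (ennreal (b / a) * (\<integral>\<^sup>+v. M (x + v) \<partial>lborel))"
    proof (intro add_mono mult_left_mono nn_integral_scales_le)
      show "(\<integral>\<^sup>+r. ennreal (1 / r) * ennreal (norm (\<rho> (y /\<^sub>R r))) \<partial>lborel) \<le> ennreal (2 * B)"
        if "y \<noteq> 0" for y
        by (rule nn_integral_scales_decay[OF \<rho>_lip \<rho>_decay B0 that])
      show "(\<integral>\<^sup>+r. ennreal (1 / r) * indicator Ann (y /\<^sub>R r) \<partial>lborel) \<le> ennreal (b / a)"
        if "y \<noteq> 0" for y
        unfolding Ann_def by (rule nn_integral_scales_annulus[OF ab that])
    qed auto
    also have "\<dots> = ennreal (2 * B) * (\<integral>\<^sup>+y. ennreal (norm (F y)) \<partial>lborel)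
        + ennreal (norm \<kappa> * (b / a)) * (\<integral>\<^sup>+v. M v \<partial>lborel)"
      using ab nn_integral_lborel_shift[of "\<lambda>y. ennreal (norm (F y))" x] nn_integral_lborel_shift[of M x]
      by (simp add: ennreal_mult mult.assoc del: times_divide_eq_right)
    also have "\<dots> \<le> ennreal (2 * B) * (\<integral>\<^sup>+v. M v \<partial>lborel) + ennreal (norm \<kappa> * (b / a)) * (\<integral>\<^sup>+v. M v \<partial>lborel)"
      by (intro add_mono mult_left_mono nn_integral_mono_AE order_refl) (use FM in \<open>auto simp: M_def\<close>)
    also have "\<dots> = ennreal (2 * B + norm \<kappa> * (b / a)) * (\<integral>\<^sup>+v. M v \<partial>lborel)"
      using ab B0 by (simp add: distrib_right ennreal_plus)
    also have "\<dots> \<le> ennreal C * hardy_norm \<Phi> (regular_distribution F)"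
      unfolding hardy_norm_regular M_def C_def by (intro mult_right_mono ennreal_leI) auto
    finally show "(\<integral>\<^sup>+r. ennreal (1 / r) * ennreal (norm (\<integral>y. F (x + y) * complex_of_real (\<omega> (y /\<^sub>R r)) \<partial>lborel)) \<partial>lborel)
        \<le> ennreal C * hardy_norm \<Phi> (regular_distribution F)" .
  qed
qed

section \<open>The mean value property up to the Hardy norm\<close>

lemma
  fixes w :: "'a::real_inner"
  shows bump_lipschitz_at_0: "\<bar>bump w - bump (0::'a)\<bar> \<le> 2 * norm w"
    and bump_decay: "norm w * \<bar>bump w\<bar> \<le> 2"
proof -
  define s where "s = norm w"
  have s: "0 \<le> s" by (simp add: s_def)
  show "\<bar>bump w - bump (0::'a)\<bar> \<le> 2 * norm w" 
  proof (cases "s \<le> 1")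
    case True
    then have q: "s\<^sup>2 \<le> s" "s\<^sup>2 \<le> 1"
      using s by (auto simp: power2_eq_square intro: mult_left_le mult_le_one)
    have "(1 - s\<^sup>2)\<^sup>2 \<le> 1"
      using q by (intro power_le_one) auto
    moreover have "1 - 2 * s\<^sup>2 \<le> (1 - s\<^sup>2)\<^sup>2"
      unfolding power2_diff by simp
    moreover have "bump w = (1 - s\<^sup>2)\<^sup>2" "bump (0::'a) = 1"
      using q by (simp_all add: bump_def s_def)
    ultimately show ?thesis
      using q by (simp flip: s_def)
  next
    case False
    then show ?thesis using bump_eq_0[of w] by (simp add: s_def) (simp add: bump_def)
  qed
  show "norm w * \<bar>bump w\<bar> \<le> 2"
  proof (cases "s \<le> 1")
    case True
    then have "s\<^sup>2 \<le> 1" using s by (simp add: power_le_one)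
    then have "bump w \<le> 1" "0 \<le> bump w"
      by (auto simp: bump_def s_def[symmetric] intro!: power_le_one)
    then have "norm w * \<bar>bump w\<bar> \<le> 1 * 1"
      using True by (intro mult_mono) (auto simp: s_def)
    then show ?thesis by simp
  next
    case False
    then show ?thesis using bump_eq_0[of w] by (simp add: s_def)
  qed
qed

lemma integral_bump_weight_pos: "0 < integral\<^sup>L lborel (bump_weight :: 'a::euclidean_space \<Rightarrow> real)"
proof -
  have "0 < 3 * measure lborel (cball (0::'a) (1/2))"
    using content_cball_pos[of "1/2" "0::'a"] by simp
  also have "\<dots> = (\<integral>z. 3 * indicator (cball (0::'a) (1/2)) z \<partial>lborel)"
    by simp
  also have "\<dots> \<le> integral\<^sup>L lborel (bump_weight :: 'a \<Rightarrow> real)"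
  proof (rule integral_mono)
    show "integrable lborel (bump_weight :: 'a \<Rightarrow> real)"
      using integrable_times_bump(2)[of 0 0 "\<lambda>_::'a. 1"] by simp
    show "3 * indicator (cball 0 (1/2)) z \<le> bump_weight z" for z :: 'a
    proof (cases "norm z \<le> 1/2")
      case True
      then have "(norm z)\<^sup>2 \<le> (1/2)\<^sup>2" by (intro power_mono) auto
      then show ?thesis using True by (simp add: bump_weight_def power2_eq_square)
    qed (simp add: bump_weight_nonneg)
    show "integrable lborel (\<lambda>z. 3 * indicator (cball (0::'a) (1/2)) z :: real)"
      using emeasure_lborel_cball_finite[of "0::'a" "1/2"]
      by (intro integrable_mult_right integrable_real_indicator) (auto simp: less_top)
  qed
  finally show ?thesis .
qed

text \<open>Dimension two matters here: rescaling \<open>r \<integral> f(x + r z) \<omega>(z) dz\<close> gives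
  \<open>r\<^bsup>1-n\<^esup> \<integral> f(x + y) \<omega>(y/r) dy\<close>, and only for \<open>n = 2\<close> is the weight in \<open>r\<close> the scale-invariant
  \<open>1/r\<close>. Letting \<open>r\<close> range over all positive radii on the right costs nothing, because the bound for
  the scales is taken with absolute values inside the \<open>r\<close>-integral.\<close>

lemma mean_value_hardy_estimate:
  fixes \<Phi> :: "real ^ 2 \<Rightarrow> complex"
  assumes \<Phi>: "\<Phi> \<in> schwartz" "integral\<^sup>L lborel \<Phi> = 1"
  obtains C where "0 < C"
    "\<And>u f S x R. \<lbrakk>open S; smooth_on S u; continuous_on S f; hardy_on \<Phi> S f;
        \<And>y. y \<in> S \<Longrightarrow> laplacian u y = f y; cball x R \<subseteq> S; 0 \<le> R\<rbrakk> \<Longrightarrow>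
      \<bar>(\<integral>z. u (x + R *\<^sub>R z) * bump_weight z \<partial>lborel)
        - u x * integral\<^sup>L lborel (bump_weight :: real ^ 2 \<Rightarrow> real)\<bar> \<le> C * hardy_norm_on \<Phi> S f"
proof -
  have bump_meas [measurable]: "(bump :: real ^ 2 \<Rightarrow> real) \<in> borel_measurable borel"
    by (rule borel_measurable_continuous_onI[OF continuous_on_bump])
  obtain C where C: "0 < C"
    and bound: "\<And>F x. \<lbrakk>integrable lborel F;
        AE y in lborel. ennreal (norm (F y)) \<le> vertical_maximal \<Phi> F y\<rbrakk> \<Longrightarrow>
      (\<integral>\<^sup>+r. ennreal (1 / r) * ennreal (norm (\<integral>y. F (x + y) * complex_of_real (bump (y /\<^sub>R r)) \<partial>lborel)) \<partial>lborel)
        \<le> ennreal C * hardy_norm \<Phi> (regular_distribution F)"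
    using hardy_multiscale_bound[OF \<Phi> bump_meas bump_lipschitz_at_0 bump_decay] by blast
  show ?thesis
  proof (rule that[OF C])
    fix u f :: "real ^ 2 \<Rightarrow> real" and S x and R :: real
    assume S: "open S" and u: "smooth_on S u" and f: "continuous_on S f"
      and hardy: "hardy_on \<Phi> S f" and lap: "\<And>y. y \<in> S \<Longrightarrow> laplacian u y = f y"
      and xR: "cball x R \<subseteq> S" and R: "0 \<le> R"
    define F where "F = zero_ext S f"
    have F: "integrable lborel F"
      using hardy by (simp add: hardy_on_def F_def)
    have [measurable]: "F \<in> borel_measurable borel"
      using F borel_measurable_integrable by auto
    have fin: "hardy_norm \<Phi> (regular_distribution F) < \<infinity>"
      using hardy by (simp add: hardy_on_def hardy_space_def F_def)
    have "ennreal (norm (F y)) \<le> vertical_maximal \<Phi> F y" for y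
    proof (cases "y \<in> S")
      case True
      have "continuous_on S F"
        by (rule continuous_on_eq[of _ "\<lambda>y. complex_of_real (f y)"])
           (auto simp: F_def zero_ext_def intro!: continuous_intros f)
      then have "isCont F y"
        using S True by (simp add: continuous_on_eq_continuous_at)
      from norm_le_vertical_maximal[OF F \<Phi> this] show ?thesis .
    qed (simp add: F_def zero_ext_def)
    then have AE: "AE y in lborel. ennreal (norm (F y)) \<le> vertical_maximal \<Phi> F y"
      by simp
    define I where "I r = r * (\<integral>z. laplacian u (x + r *\<^sub>R z) * bump z \<partial>lborel)" for r
    have I: "ennreal (norm (indicator {0..R} r *\<^sub>R I r))
        \<le> ennreal (1 / r) * ennreal (norm (\<integral>y. F (x + y) * complex_of_real (bump (y /\<^sub>R r)) \<partial>lborel))" for r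
    proof (cases "0 < r \<and> r \<le> R")
      case True
      then have r: "0 < r" "r \<le> R" by auto
      have pt: "F (x + r *\<^sub>R z) * complex_of_real (bump z)
          = complex_of_real (laplacian u (x + r *\<^sub>R z) * bump z)" for z
      proof (cases "norm z \<le> 1")
        case True
        then have "x + r *\<^sub>R z \<in> S"
          using add_scaleR_mem_cball[of z r R x] r xR by auto
        then show ?thesis by (simp add: F_def zero_ext_def lap)
      qed (simp add: bump_eq_0)
      have "(\<integral>y. F (x + y) * complex_of_real (bump (y /\<^sub>R r)) \<partial>lborel)
          = r\<^sup>2 *\<^sub>R (\<integral>z. F (x + r *\<^sub>R z) * complex_of_real (bump z) \<partial>lborel)"
        using r by (subst integral_lborel_affine[of _ r 0]) auto
      also have "\<dots> = complex_of_real (r * I r)"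
        by (simp only: pt integral_complex_of_real) (simp add: I_def power2_eq_square scaleR_conv_of_real)
      finally have "norm (\<integral>y. F (x + y) * complex_of_real (bump (y /\<^sub>R r)) \<partial>lborel) = r * \<bar>I r\<bar>"
        using r by (simp only: norm_of_real abs_mult)
      then have "ennreal (1 / r) * ennreal (norm (\<integral>y. F (x + y) * complex_of_real (bump (y /\<^sub>R r)) \<partial>lborel))
          = ennreal \<bar>I r\<bar>"
        using r by (simp flip: ennreal_mult)
      then show ?thesis using r by simp
    next
      case False
      then have "indicator {0..R} r *\<^sub>R I r = 0" by (auto simp: indicator_def I_def)
      then show ?thesis by (simp only: norm_zero ennreal_0 zero_le)
    qed
    have "ennreal \<bar>(\<integral>z. u (x + R *\<^sub>R z) * bump_weight z \<partial>lborel)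
        - u x * integral\<^sup>L lborel (bump_weight :: real ^ 2 \<Rightarrow> real)\<bar>
      = ennreal (norm (\<integral>r. indicator {0..R} r *\<^sub>R I r \<partial>lborel))"
      using mean_value_defect(2)[OF u xR R] by (simp add: I_def)
    also have "\<dots> \<le> (\<integral>\<^sup>+r. ennreal (norm (indicator {0..R} r *\<^sub>R I r)) \<partial>lborel)"
      using mean_value_defect(1)[OF u xR R] unfolding I_def
      by (intro integral_norm_bound_ennreal)
    also have "\<dots> \<le> (\<integral>\<^sup>+r. ennreal (1 / r) *
        ennreal (norm (\<integral>y. F (x + y) * complex_of_real (bump (y /\<^sub>R r)) \<partial>lborel)) \<partial>lborel)"
      by (rule nn_integral_mono) (rule I)
    also have "\<dots> \<le> ennreal C * hardy_norm \<Phi> (regular_distribution F)"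
      by (rule bound[OF F AE])
    also have "\<dots> = ennreal (C * hardy_norm_on \<Phi> S f)"
      using fin C by (simp add: hardy_norm_on_def ennreal_mult F_def ennreal_enn2real)
    finally show "\<bar>(\<integral>z. u (x + R *\<^sub>R z) * bump_weight z \<partial>lborel)
        - u x * integral\<^sup>L lborel (bump_weight :: real ^ 2 \<Rightarrow> real)\<bar> \<le> C * hardy_norm_on \<Phi> S f"
      using C by (subst (asm) ennreal_le_iff) (auto simp: hardy_norm_on_def)
  qed
qed

section \<open>The Harnack inequality\<close>

text \<open>On the disk of radius \<open>1/8\<close> around \<open>x\<close>, which lies in the disk of radius \<open>1/4\<close> around \<open>y\<close>, the
  weight of the larger mean is at least \<open>4 (1 - (2/3)\<^sup>2) = 20/9\<close>, whereas the weight of the smaller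
  mean never exceeds \<open>4\<close>. Taking the areas into account, the ratio is
  \<open>9 \<cdot> 9/5 = 81/5 \<le> 17\<close>.\<close>

lemma weighted_means_comparison:
  fixes u :: "real ^ 2 \<Rightarrow> real"
  assumes S: "continuous_on S u" "\<And>w. w \<in> S \<Longrightarrow> 0 \<le> u w"
    and x: "cball x (1/8) \<subseteq> S" and y: "cball y (3/8) \<subseteq> S" and xy: "dist x y \<le> 1/8"
  shows "(\<integral>z. u (x + (1/8) *\<^sub>R z) * bump_weight z \<partial>lborel)
    \<le> 17 * (\<integral>z. u (y + (3/8) *\<^sub>R z) * bump_weight z \<partial>lborel)"
proof -
  define g where "g c r w = u w * bump_weight ((w - c) /\<^sub>R r)" for c r w
  have int: "integrable lborel (g c r)" if "cball c r \<subseteq> S" "0 < r" for c r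
  proof (rule integrable_compact_support[of "cball c r"])
    show "continuous_on (cball c r) (g c r)"
      unfolding g_def
      by (intro continuous_intros continuous_on_subset[OF S(1) that(1)]
            continuous_on_compose2[OF continuous_on_bump_weight[of UNIV]]) auto
    show "g c r w = 0" if "w \<notin> cball c r" for w
    proof -
      have "1 \<le> norm (w - c) / r"
        using that \<open>0 < r\<close> by (simp add: dist_norm norm_minus_commute)
      also have "\<dots> = norm ((w - c) /\<^sub>R r)"
        using \<open>0 < r\<close> by (simp add: divide_inverse mult.commute)
      finally show ?thesis by (simp add: g_def bump_weight_eq_0)
    qed
  qed simp
  have scale: "(\<integral>w. g c r w \<partial>lborel) = r\<^sup>2 * (\<integral>z. u (c + r *\<^sub>R z) * bump_weight z \<partial>lborel)"
    if "cball c r \<subseteq> S" "0 < r" for c r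
    using that borel_measurable_integrable[OF int[OF that]]
    by (subst integral_lborel_affine[of _ r c]) (auto simp: g_def)
  have "g x (1/8) w \<le> 9/5 * g y (3/8) w" for w
  proof (cases "dist w x \<le> 1/8")
    case True
    have wy: "dist w y \<le> 1/4" using dist_triangle[of w y x] True xy by simp
    then have "w \<in> S" using y by (auto simp: dist_commute)
    have "norm ((w - y) /\<^sub>R (3/8)) \<le> 2/3" using wy by (simp add: dist_norm)
    then have "(norm ((w - y) /\<^sub>R (3/8)))\<^sup>2 \<le> (2/3)\<^sup>2" by (intro power_mono) auto
    then have "20/9 \<le> bump_weight ((w - y) /\<^sub>R (3/8))"
      unfolding bump_weight_def by (simp add: power2_eq_square)
    moreover have "bump_weight ((w - x) /\<^sub>R (1/8)) \<le> 4"
      unfolding bump_weight_def by simp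
    ultimately have "bump_weight ((w - x) /\<^sub>R (1/8)) \<le> 9/5 * bump_weight ((w - y) /\<^sub>R (3/8))"
      by linarith
    from mult_left_mono[OF this S(2)[OF \<open>w \<in> S\<close>]] show ?thesis
      by (simp add: g_def mult_ac)
  next
    case False
    then have "g x (1/8) w = 0"
      by (auto simp: g_def dist_norm intro!: bump_weight_eq_0)
    moreover have "0 \<le> g y (3/8) w"
    proof (cases "w \<in> cball y (3/8)")
      case True
      then show ?thesis using y S(2) by (auto simp: g_def bump_weight_nonneg)
    next
      case False
      then have "g y (3/8) w = 0"
        by (auto simp: g_def dist_norm norm_minus_commute intro!: bump_weight_eq_0)
      then show ?thesis by simp
    qed
    ultimately show ?thesis by simp
  qed
  then have "(\<integral>w. g x (1/8) w \<partial>lborel) \<le> (\<integral>w. 9/5 * g y (3/8) w \<partial>lborel)"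
    using int[OF x] int[OF y] by (intro integral_mono) auto
  then have le: "(1/8)\<^sup>2 * (\<integral>z. u (x + (1/8) *\<^sub>R z) * bump_weight z \<partial>lborel)
      \<le> 9/5 * ((3/8)\<^sup>2 * (\<integral>z. u (y + (3/8) *\<^sub>R z) * bump_weight z \<partial>lborel))"
    using scale[OF x] scale[OF y] by simp
  have nonneg: "0 \<le> (\<integral>z. u (y + (3/8) *\<^sub>R z) * bump_weight z \<partial>lborel)"
  proof (rule Bochner_Integration.integral_nonneg)
    fix z :: "real ^ 2"
    show "0 \<le> u (y + (3/8) *\<^sub>R z) * bump_weight z"
    proof (cases "norm z \<le> 1")
      case True
      then show ?thesis
        using add_scaleR_mem_cball[of z "3/8" "3/8" y] y S(2) by (auto simp: bump_weight_nonneg)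
    qed (simp add: bump_weight_eq_0)
  qed
  show ?thesis using le nonneg by (simp add: power2_eq_square)
qed

text \<open>A comparison between nearby points is iterated along the segment from \<open>y\<close> to \<open>x\<close>, cut into
  \<open>n\<close> equal pieces.\<close>

lemma chain_inequality:
  fixes v :: "'a::real_normed_vector \<Rightarrow> real"
  assumes S: "convex S" "x \<in> S" "y \<in> S" and K: "0 \<le> K" and n: "0 < n"
    and step: "\<And>p q. \<lbrakk>p \<in> S; q \<in> S; dist p q \<le> dist x y / real n\<rbrakk> \<Longrightarrow> v p \<le> K * v q"
  shows "v x \<le> K ^ n * v y"
proof -
  define p where "p i = y + (real i / real n) *\<^sub>R (x - y)" for i
  have "v (p i) \<le> K ^ i * v y" if "i \<le> n" for i
    using that
  proof (induction i)
    case 0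
    then show ?case by (simp add: p_def)
  next
    case (Suc i)
    have mem: "p j \<in> S" if "j \<le> n" for j
    proof -
      have "p j = (1 - real j / real n) *\<^sub>R y + (real j / real n) *\<^sub>R x"
        by (simp add: p_def algebra_simps)
      then show ?thesis using S n that by (auto intro!: convexD_alt)
    qed
    have "p (Suc i) - p i = (1 / real n) *\<^sub>R (x - y)"
      by (simp add: p_def add_divide_distrib algebra_simps)
    then have "dist (p (Suc i)) (p i) = dist x y / real n"
      by (simp add: dist_norm)
    then have "v (p (Suc i)) \<le> K * v (p i)"
      using Suc.prems by (intro step mem) auto
    also have "\<dots> \<le> K * (K ^ i * v y)"
      using Suc K by (intro mult_left_mono) auto
    finally show ?case by (simp add: mult_ac)
  qed
  from this[of n] show ?thesis using n by (simp add: p_def)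
qed

theorem corollary1p5:
  fixes \<Phi> :: "real ^ 2 \<Rightarrow> complex"
  assumes "\<Phi> \<in> schwartz" and "(LINT x|lborel. \<Phi> x) = 1"
  shows "\<exists>C>0. \<forall>(u :: real ^ 2 \<Rightarrow> real) (f :: real ^ 2 \<Rightarrow> real).
    smooth_on (ball 0 1) u \<longrightarrow>
    smooth_on (ball 0 1) f \<longrightarrow>
    hardy_on \<Phi> (ball 0 1) f \<longrightarrow>
    (\<forall>x\<in>ball 0 1. u x \<ge> 0) \<longrightarrow>
    (\<forall>x\<in>ball 0 1. laplacian u x = f x) \<longrightarrow>
    (SUP x\<in>ball 0 (1/2). u x) \<le> C * ((INF y\<in>ball 0 (1/2). u y) + hardy_norm_on \<Phi> (ball 0 1) f)"
proof -
  define c where "c = integral\<^sup>L lborel (bump_weight :: real ^ 2 \<Rightarrow> real)"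
  have c: "0 < c" unfolding c_def by (rule integral_bump_weight_pos)
  obtain D where D: "0 < D"
    and est: "\<And>u f S x R. \<lbrakk>open S; smooth_on S u; continuous_on S f; hardy_on \<Phi> S f;
        \<And>y. y \<in> S \<Longrightarrow> laplacian u y = f y; cball x R \<subseteq> S; 0 \<le> R\<rbrakk> \<Longrightarrow>
      \<bar>(\<integral>z. u (x + R *\<^sub>R z) * bump_weight z \<partial>lborel) - u x * c\<bar> \<le> D * hardy_norm_on \<Phi> S f"
    using mean_value_hardy_estimate[OF assms] unfolding c_def by blast
  \<comment> \<open>One \<open>18\<close> is the factor \<open>17\<close> of the comparison of means plus \<open>1\<close> for the term \<open>H\<close> on the left;
  the other counts the errors \<open>D H\<close>: \<open>17\<close> at \<open>q\<close> and one at \<open>p\<close>.\<close>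
  define K where "K = 18 + 18 * D / c"
  have K: "0 < K" using c D by (simp add: K_def add_pos_pos)
  show ?thesis
  proof (intro exI[of _ "K ^ 8"] conjI allI impI)
    show "0 < K ^ 8" using K by simp
    fix u f :: "real ^ 2 \<Rightarrow> real"
    assume u: "smooth_on (ball 0 1) u" and f: "smooth_on (ball 0 1) f"
      and hardy: "hardy_on \<Phi> (ball 0 1) f"
      and nonneg: "\<forall>x\<in>ball 0 1. 0 \<le> u x" and lap: "\<forall>x\<in>ball 0 1. laplacian u x = f x"
    define H where "H = hardy_norm_on \<Phi> (ball 0 1) f"
    have H: "0 \<le> H" by (simp add: H_def hardy_norm_on_def)
    have sub: "cball x R \<subseteq> ball 0 1" if "x \<in> ball 0 (1/2)" "R \<le> 3/8" for x :: "real ^ 2" and R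
    proof
      fix w assume "w \<in> cball x R"
      then show "w \<in> ball 0 1" using that dist_triangle[of 0 w x] by simp
    qed
    have mean: "\<bar>(\<integral>z. u (x + R *\<^sub>R z) * bump_weight z \<partial>lborel) - u x * c\<bar> \<le> D * H"
      if "x \<in> ball 0 (1/2)" "0 \<le> R" "R \<le> 3/8" for x R
      unfolding H_def
      by (rule est[OF open_ball u smooth_on_continuous_on[OF f] hardy])
         (use lap sub that in auto)
    \<comment> \<open>The quantity \<open>u + H\<close> is compared, rather than \<open>u\<close>, so that the additive error is absorbed into
    the factor and the comparison can be iterated.\<close>
    have local: "u p + H \<le> K * (u q + H)"
      if p: "p \<in> ball 0 (1/2)" and q: "q \<in> ball 0 (1/2)" and pq: "dist p q \<le> 1/8" for p q
    proof -
      have uq: "0 \<le> u q" using nonneg q by simp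
      have "u p * c \<le> (\<integral>z. u (p + (1/8) *\<^sub>R z) * bump_weight z \<partial>lborel) + D * H"
        using mean[OF p, of "1/8"] by (simp add: abs_le_iff)
      also have "\<dots> \<le> 17 * (\<integral>z. u (q + (3/8) *\<^sub>R z) * bump_weight z \<partial>lborel) + D * H"
        using weighted_means_comparison[OF smooth_on_continuous_on[OF u] _ sub[OF p] sub[OF q] pq]
          nonneg by simp
      also have "\<dots> \<le> 17 * (u q * c + D * H) + D * H"
        using mean[OF q, of "3/8"] by (simp add: abs_le_iff)
      finally have "u p * c \<le> (17 * u q + 18 * D / c * H) * c"
        using c by (simp add: algebra_simps)
      then have "u p \<le> 17 * u q + 18 * D / c * H"
        using c by simp
      also have "\<dots> \<le> K * (u q + H) - H"
      proof -
        define e where "e = 18 * D / c"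
        have "0 \<le> e" using c D by (simp add: e_def)
        then have "0 \<le> e * u q" using uq by simp
        then show ?thesis
          unfolding K_def e_def[symmetric] using uq H by (simp add: algebra_simps)
      qed
      finally show ?thesis by simp
    qed
    have global: "u x + H \<le> K ^ 8 * (u y + H)"
      if x: "x \<in> ball 0 (1/2)" and y: "y \<in> ball 0 (1/2)" for x y
    proof (rule chain_inequality[of "ball 0 (1/2)" x y K 8 "\<lambda>p. u p + H"])
      have "dist x y \<le> 1" using x y dist_triangle2[of x y 0] by (simp add: dist_commute)
      then show "u p + H \<le> K * (u q + H)"
        if "p \<in> ball 0 (1/2)" "q \<in> ball 0 (1/2)" "dist p q \<le> dist x y / real 8" for p q
        using that by (intro local) auto
    qed (use x y K in auto)
    have "(SUP x\<in>ball 0 (1/2). u x) \<le> K ^ 8 * ((INF y\<in>ball 0 (1/2). u y) + H)"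
    proof (rule cSUP_least)
      fix x :: "real ^ 2" assume x: "x \<in> ball 0 (1/2)"
      have "u x / K ^ 8 - H \<le> (INF y\<in>ball 0 (1/2). u y)"
      proof (rule cINF_greatest)
        fix y :: "real ^ 2" assume y: "y \<in> ball 0 (1/2)"
        have "u x \<le> K ^ 8 * (u y + H)" using global[OF x y] H by simp
        then have "u x / K ^ 8 \<le> u y + H" using K by (simp add: divide_le_eq mult.commute)
        then show "u x / K ^ 8 - H \<le> u y" by simp
      qed simp
      then have "u x / K ^ 8 \<le> (INF y\<in>ball 0 (1/2). u y) + H" by simp
      then show "u x \<le> K ^ 8 * ((INF y\<in>ball 0 (1/2). u y) + H)"
        using K by (simp add: divide_le_eq mult.commute)
    qed simp
    then show "(SUP x\<in>ball 0 (1/2). u x)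
        \<le> K ^ 8 * ((INF y\<in>ball 0 (1/2). u y) + hardy_norm_on \<Phi> (ball 0 1) f)"
      by (simp add: H_def)
  qed
qed

end
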